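(* Let $G=(V,A)$ be either a finite undirected graph or a finite acyclic directed graph, and let $B,C,E\subseteq V$ be three sets of vertices. Then the Markov blanket $\mathrm{mb}_C(B|E)$ of $B$ in $C$ given $E$ (defined in the context) exists, is unique, and is equal to $$\mathrm{mb}_C(B|E)=\Big\{v\in C:\ v \text{ is not separated (resp. d-separated) from } B \text{ given } E\cup\big(C\setminus(B\cup\{v\})\big)\Big\},$$ where "separated" applies if $G$ is undirected and "d-separated" applies if $G$ is directed.
   Context: Markov blanket in a set. The Markov blanket of $B$ in $C$ given $E$, denoted $\mathrm{mb}_C(B|E)$, is the smallest subset $M\subseteq C$ satisfying $$( * )\qquad X_B \text{ is independent of } X_{C\setminus(B\cup M)} \text{ given } X_{M\cup E}\text{ for every distribution that factorizes on } G,$$ where "smallest" means that a set $M\subseteq C$ satisfies $( * )$ if and only if $\mathrm{mb}_C(B|E)\subseteq M$. Factorization. To each $v\in V$ is associated a random variable $X_v$ with values in a finite set $\mathcal X_v$; for $S\subseteq V$, $X_S=(X_v)_{v\in S}$ and $\mathcal X_S=\prod_{v\in S}\mathcal X_v$. If $G$ is undirected, a distribution $\mathbb P$ on $\mathcal X_V$ factorizes on $G$ if there are a collection $\mathcal C$ of cliques of $G$ and maps $\psi_K:\mathcal X_K\to\mathbb R_+$, $K\in\mathcal C$, with $\mathbb P(X_V=x_V)=\frac1Z\prod_{K\in\mathcal C}\psi_K(x_K)$ for a normalizing constant $Z$. If $G$ is an acyclic directed graph, $\mathbb P$ factorizes on $G$ if $\mathbb P(x_V)=\prod_{v\in V}p_v(x_v|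 x_{\mathrm{prt}(v)})$ for some conditional distributions $p_v$ of $v$ given its set of parents $\mathrm{prt}(v)$. "Every distribution that factorizes on $G$" ranges over all choices of the finite sets $\mathcal X_v$. Separation (undirected $G$). A path is a sequence $v_0,\dots,v_k$ ($k\ge 0$) of vertices with consecutive vertices adjacent. It is active given $Z\subseteq V$ if none of its vertices is in $Z$. $Z$ separates $X$ and $Y$ if there is no path active given $Z$ between a vertex of $X$ and a vertex of $Y$. d-separation (acyclic directed $G$). A trail is a sequence $v_0,\dots,v_k$ ($k\ge0$) of vertices such that for each $1\le i\le k$, $(v_{i-1},v_i)\in A$ or $(v_i,v_{i-1})\in A$. The vertex $v_i$ is a v-structure of the trail if $0<i<k$ and $(v_{i-1},v_i),(v_{i+1},v_i)\in A$. Let $\overline{\mathrm{dsc}}(v)$ be $v$ together with all vertices reachable from $v$ by a directed path. A trail is active given $Z\subseteq V$ if every vertex of it that is not a v-structure is not in $Z$, and every v-structure $v$ of it satisfies $\overline{\mathrm{dsc}}(v)\cap Z\ne\emptyset$. $Z$ d-separates $X$ and $Y$ if there is no trail active given $Z$ between a vertex of $X$ and a vertex of $Y$. Standard fact: $X_S$ is independent of $X_T$ given $X_Z$ for every distribution factorizing on $G$ if and only if $Z$ separates (undirected case), resp. d-separates (directed case), $S$ and $T$.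
   Formalization: The formal statement adds the hypothesis B∩C ⊆ E; without it the claim always fails: for v in B∩C outside E the formula contains v, yet M = C∖B satisfies ( * ) trivially and omits v (e.g. V=B=C={b}, E=∅). *)

theory Defs
  imports "HOL-Probability.Probability"
begin

section \<open>Graphs\<close>

text \<open>
  A graph is a vertex set \<open>V\<close> with an adjacency relation \<open>A\<close>; an undirected edge between
  \<open>u\<close> and \<open>v\<close> is the pair of arcs \<open>(u, v)\<close> and \<open>(v, u)\<close>. Loops are not excluded in the undirected
  case: neither cliques nor separation depend on them.
\<close>

definition finite_undirected_graph :: "'v set \<Rightarrow> 'v rel \<Rightarrow> bool" where
  "finite_undirected_graph V A \<longleftrightarrow> finite V \<and> A \<subseteq> V \<times> V \<and> sym A"

definition finite_acyclic_digraph :: "'v set \<Rightarrow> 'v rel \<Rightarrow> bool" where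
  "finite_acyclic_digraph V A \<longleftrightarrow> finite V \<and> A \<subseteq> V \<times> V \<and> acyclic A"

definition clique :: "'v set \<Rightarrow> 'v rel \<Rightarrow> 'v set \<Rightarrow> bool" where
  "clique V A K \<longleftrightarrow> K \<subseteq> V \<and> (\<forall>u\<in>K. \<forall>v\<in>K. u \<noteq> v \<longrightarrow> (u, v) \<in> A)"

definition parents :: "'v rel \<Rightarrow> 'v \<Rightarrow> 'v set" where
  "parents A v = {u. (u, v) \<in> A}"

definition descendants :: "'v rel \<Rightarrow> 'v \<Rightarrow> 'v set" where
  "descendants A v = A\<^sup>* `` {v}"


section \<open>Separation\<close>

definition graph_path :: "'v set \<Rightarrow> 'v rel \<Rightarrow> 'v list \<Rightarrow> bool" where
  "graph_path V A vs \<longleftrightarrow> vs \<noteq> [] \<and> set vs \<subseteq> V \<and> successively (\<lambda>u v. (u, v) \<in> A) vs"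

definition path_active :: "'v set \<Rightarrow> 'v list \<Rightarrow> bool" where
  "path_active Z vs \<longleftrightarrow> (\<forall>v\<in>set vs. v \<notin> Z)"

definition separates :: "'v set \<Rightarrow> 'v rel \<Rightarrow> 'v set \<Rightarrow> 'v set \<Rightarrow> 'v set \<Rightarrow> bool" where
  "separates V A Z X Y \<longleftrightarrow>
     \<not> (\<exists>vs. graph_path V A vs \<and> path_active Z vs \<and> hd vs \<in> X \<and> last vs \<in> Y)"

definition trail :: "'v set \<Rightarrow> 'v rel \<Rightarrow> 'v list \<Rightarrow> bool" where
  "trail V A vs \<longleftrightarrow>
     vs \<noteq> [] \<and> set vs \<subseteq> V \<and> successively (\<lambda>u v. (u, v) \<in> A \<or> (v, u) \<in> A) vs"

text \<open>
  Vertices may repeat in a trail, so being a v-structure is a property of a position \<open>i\<close>.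
\<close>

definition v_structure :: "'v rel \<Rightarrow> 'v list \<Rightarrow> nat \<Rightarrow> bool" where
  "v_structure A vs i \<longleftrightarrow>
     0 < i \<and> Suc i < length vs \<and> (vs ! (i - 1), vs ! i) \<in> A \<and> (vs ! Suc i, vs ! i) \<in> A"

definition trail_active :: "'v rel \<Rightarrow> 'v set \<Rightarrow> 'v list \<Rightarrow> bool" where
  "trail_active A Z vs \<longleftrightarrow>
     (\<forall>i<length vs. if v_structure A vs i then descendants A (vs ! i) \<inter> Z \<noteq> {} else vs ! i \<notin> Z)"

definition d_separates :: "'v set \<Rightarrow> 'v rel \<Rightarrow> 'v set \<Rightarrow> 'v set \<Rightarrow> 'v set \<Rightarrow> bool" where
  "d_separates V A Z X Y \<longleftrightarrow>
     \<not> (\<exists>vs. trail V A vs \<and> trail_active A Z vs \<and> hd vs \<in> X \<and> last vs \<in> Y)"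


section \<open>Distributions and factorization\<close>

text \<open>
  The value set of the variable at \<open>v\<close> is a finite set \<open>\<X> v\<close> of naturals: every finite set is in
  bijection with such a set, so quantifying over \<open>\<X>\<close> covers all choices of finite value sets.
  A configuration of the variables in \<open>W\<close> is an element of \<open>Pi\<^sub>E W \<X>\<close>, and the subvector of
  \<open>x\<close> indexed by \<open>W\<close> is \<open>restrict x W\<close>.
\<close>

definition distribution_on :: "'v set \<Rightarrow> ('v \<Rightarrow> nat set) \<Rightarrow> ('v \<Rightarrow> nat) pmf \<Rightarrow> bool" where
  "distribution_on V \<X> p \<longleftrightarrow> (\<forall>v\<in>V. finite (\<X> v)) \<and> set_pmf p \<subseteq> Pi\<^sub>E V \<X>"

definition factorizes_undirected ::
    "'v set \<Rightarrow> 'v rel \<Rightarrow> ('v \<Rightarrow> nat set) \<Rightarrow> ('v \<Rightarrow> nat) pmf \<Rightarrow> bool" where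
  "factorizes_undirected V A \<X> p \<longleftrightarrow> distribution_on V \<X> p \<and>
     (\<exists>\<C> (\<psi> :: 'v set \<Rightarrow> ('v \<Rightarrow> nat) \<Rightarrow> real) (c :: real).
        (\<forall>K\<in>\<C>. clique V A K \<and> (\<forall>y\<in>Pi\<^sub>E K \<X>. 0 \<le> \<psi> K y)) \<and> 0 < c \<and>
        (\<forall>x\<in>Pi\<^sub>E V \<X>. pmf p x = 1 / c * (\<Prod>K\<in>\<C>. \<psi> K (restrict x K))))"

definition factorizes_directed ::
    "'v set \<Rightarrow> 'v rel \<Rightarrow> ('v \<Rightarrow> nat set) \<Rightarrow> ('v \<Rightarrow> nat) pmf \<Rightarrow> bool" where
  "factorizes_directed V A \<X> p \<longleftrightarrow> distribution_on V \<X> p \<and>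
     (\<exists>\<kappa> :: 'v \<Rightarrow> ('v \<Rightarrow> nat) \<Rightarrow> nat pmf.
        (\<forall>v\<in>V. \<forall>y\<in>Pi\<^sub>E (parents A v) \<X>. set_pmf (\<kappa> v y) \<subseteq> \<X> v) \<and>
        (\<forall>x\<in>Pi\<^sub>E V \<X>. pmf p x = (\<Prod>v\<in>V. pmf (\<kappa> v (restrict x (parents A v))) (x v))))"


section \<open>Conditional independence and Markov blankets\<close>

text \<open>
  The subvectors indexed by \<open>S\<close> and \<open>T\<close> are independent under the conditional law given each
  value \<open>z\<close> that the subvector indexed by \<open>Z\<close> takes with positive probability.
  The sets \<open>S\<close>, \<open>T\<close>, \<open>Z\<close> may overlap.
\<close>

definition cond_indep :: "('v \<Rightarrow> nat) pmf \<Rightarrow> 'v set \<Rightarrow> 'v set \<Rightarrow> 'v set \<Rightarrow> bool" where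
  "cond_indep p S T Z \<longleftrightarrow>
     (\<forall>z \<in> (\<lambda>x. restrict x Z) ` set_pmf p.
        prob_space.indep_var (measure_pmf (cond_pmf p {x. restrict x Z = z}))
          (count_space UNIV) (\<lambda>x. restrict x S)
          (count_space UNIV) (\<lambda>x. restrict x T))"

text \<open>
  The parameter \<open>F\<close> below is the factorization predicate of a graph
  (\<open>factorizes_undirected V A\<close> or \<open>factorizes_directed V A\<close>).
\<close>

definition blanket_condition ::
    "(('v \<Rightarrow> nat set) \<Rightarrow> ('v \<Rightarrow> nat) pmf \<Rightarrow> bool) \<Rightarrow> 'v set \<Rightarrow> 'v set \<Rightarrow> 'v set \<Rightarrow> 'v set \<Rightarrow> bool" where
  "blanket_condition F C B E M \<longleftrightarrow>
     (\<forall>\<X> p. F \<X> p \<longrightarrow> cond_indep p B (C - (B \<union> M)) (M \<union> E))"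

definition is_markov_blanket ::
    "(('v \<Rightarrow> nat set) \<Rightarrow> ('v \<Rightarrow> nat) pmf \<Rightarrow> bool) \<Rightarrow> 'v set \<Rightarrow> 'v set \<Rightarrow> 'v set \<Rightarrow> 'v set \<Rightarrow> bool" where
  "is_markov_blanket F C B E N \<longleftrightarrow>
     N \<subseteq> C \<and> (\<forall>M\<subseteq>C. blanket_condition F C B E M \<longleftrightarrow> N \<subseteq> M)"

definition markov_blanket ::
    "(('v \<Rightarrow> nat set) \<Rightarrow> ('v \<Rightarrow> nat) pmf \<Rightarrow> bool) \<Rightarrow> 'v set \<Rightarrow> 'v set \<Rightarrow> 'v set \<Rightarrow> 'v set" where
  "markov_blanket F C B E = (THE N. is_markov_blanket F C B E N)"

end

theory Submission
  imports Defs "HOL-Library.Nat_Bijection"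
begin

text \<open>
  Let \<open>N\<close> be the set of the theorem. Uniqueness is formal, so the claim is that, for
  \<open>M \<subseteq> C\<close>, the blanket condition for \<open>M\<close> is equivalent to \<open>N \<subseteq> M\<close>. This splits into two steps.

  The first step turns probability into combinatorics: conditional independence under every
  factorizing distribution is the same as separation (\<open>global_markov_undirected\<close>,
  \<open>global_markov_directed\<close>). For the direction from separation to independence, let \<open>U\<close> be the set
  of vertices reached from \<open>S\<close> by active paths or trails. Every factor of the density depends on
  variables in \<open>U \<union> Z\<close> only or on variables outside \<open>U\<close> only, so the product \<open>p x * p y\<close> does not
  change when two configurations that agree on \<open>Z\<close> exchange their coordinates in \<open>U\<close>; this symmetry
  is conditional independence (\<open>cond_indep_if_exchangeable\<close>). In a directed graph the exchange works
  only after the variables that are no ancestors of \<open>S \<union> T \<union> Z\<close> have been summed out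
  (\<open>sum_bayes_weights_marginal\<close>, \<open>active_reachability_family_split\<close>). For the converse, an active
  path or trail carries a bit from one end to the other without revealing it on \<open>Z\<close>. The resulting
  dependence is visible from the support of the distribution alone: two configurations of positive
  probability agree on \<open>Z\<close>, but the \<open>S\<close>-part of the first is incompatible with the \<open>T\<close>-part of the
  second (\<open>not_cond_indep_if_incompatible\<close>). So only the supports have to be computed.

  The second step is graph theory (\<open>separates_outside_iff_each\<close>, \<open>d_separates_outside_iff_each\<close>):
  \<open>M \<union> E\<close> separates \<open>C - (B \<union> M)\<close> from \<open>B\<close> if and only if every vertex that, given \<open>E\<close> and all
  the rest of \<open>C - B\<close>, is not separated from \<open>B\<close> lies in \<open>M\<close>. To enlarge the conditioning set,
  one cuts an active path or trail at its last vertex in \<open>C - (B \<union> M \<union> E)\<close>. Shrinking it is harmless for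
  paths; a trail is cut at the last vertex that loses all its observed descendants, and a directed
  path to one of these descendants, walked backwards, replaces the part that was cut off.
\<close>

section \<open>Conditional independence of finitely supported vectors\<close>

text \<open>
  Multiplied out, the condition holds trivially for a value \<open>z\<close> of probability \<open>0\<close>, so that
  conditional laws disappear and \<open>z\<close> ranges over everything.
\<close>

lemma cond_indep_iff_events:
  "cond_indep p S T Z \<longleftrightarrow>
     (\<forall>z Q R.
        measure p {x. restrict x Z = z \<and> restrict x S \<in> Q \<and> restrict x T \<in> R} *
          measure p {x. restrict x Z = z} =
        measure p {x. restrict x Z = z \<and> restrict x S \<in> Q} *
          measure p {x. restrict x Z = z \<and> restrict x T \<in> R})"
proof -
  have main: "prob_space.indep_var (measure_pmf (cond_pmf p {x. restrict x Z = z}))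
          (count_space UNIV) (\<lambda>x. restrict x S) (count_space UNIV) (\<lambda>x. restrict x T) \<longleftrightarrow>
        (\<forall>Q R.
        measure p {x. restrict x Z = z \<and> restrict x S \<in> Q \<and> restrict x T \<in> R} *
          measure p {x. restrict x Z = z} =
        measure p {x. restrict x Z = z \<and> restrict x S \<in> Q} *
          measure p {x. restrict x Z = z \<and> restrict x T \<in> R})"
    if z: "z \<in> (\<lambda>x. restrict x Z) ` set_pmf p" for z
  proof -
    let ?c = "{x. restrict x Z = z}"
    let ?q = "cond_pmf p ?c"
    have ne: "set_pmf p \<inter> ?c \<noteq> {}"
      using z by auto
    then have pos: "measure p ?c \<noteq> 0"
      by (auto simp: measure_pmf_zero_iff)
    have cond: "measure ?q D = measure p {x. restrict x Z = z \<and> x \<in> D} / measure p ?c" for D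
    proof -
      have "emeasure ?q D = emeasure p (?c \<inter> D) / emeasure p ?c"
        unfolding cond_pmf.rep_eq[OF ne] by (subst emeasure_uniform_measure) auto
      also have "\<dots> = ennreal (measure p (?c \<inter> D) / measure p ?c)"
        unfolding measure_pmf.emeasure_eq_measure
        using pos by (intro divide_ennreal) (auto simp: zero_less_measure_iff)
      finally have "measure ?q D = measure p (?c \<inter> D) / measure p ?c"
        by (simp add: measure_def)
      also have "?c \<inter> D = {x. restrict x Z = z \<and> x \<in> D}"
        by auto
      finally show ?thesis .
    qed
    have stable: "Int_stable {(f -` Q :: ('a \<Rightarrow> nat) set) | Q. True}" for f :: "('a \<Rightarrow> nat) \<Rightarrow> ('a \<Rightarrow> nat)"
      by (rule Int_stableI) (auto, metis vimage_Int)
    have "prob_space.indep_var (measure_pmf ?q)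
          (count_space UNIV) (\<lambda>x. restrict x S) (count_space UNIV) (\<lambda>x. restrict x T) \<longleftrightarrow>
        (\<forall>Q R. measure ?q ((\<lambda>x. restrict x S) -` Q \<inter> (\<lambda>x. restrict x T) -` R) =
          measure ?q ((\<lambda>x. restrict x S) -` Q) * measure ?q ((\<lambda>x. restrict x T) -` R))"
      (is "?L \<longleftrightarrow> ?R")
    proof
      assume L: ?L
      show ?R
      proof (intro allI)
        fix Q R
        show "measure ?q ((\<lambda>x. restrict x S) -` Q \<inter> (\<lambda>x. restrict x T) -` R) =
          measure ?q ((\<lambda>x. restrict x S) -` Q) * measure ?q ((\<lambda>x. restrict x T) -` R)"
          using prob_space.indep_varD[OF prob_space_measure_pmf L, of Q R] by (auto simp: vimage_def Int_def)
      qed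
    next
      assume R: ?R
      show ?L
        unfolding prob_space.indep_var_eq[OF prob_space_measure_pmf]
        by (intro conjI prob_space.indep_set_sigma_sets[OF prob_space_measure_pmf])
          (use R stable in \<open>auto simp: prob_space.indep_sets2_eq[OF prob_space_measure_pmf]\<close>)
    qed
    also have "\<dots> \<longleftrightarrow> (\<forall>Q R.
        measure p {x. restrict x Z = z \<and> restrict x S \<in> Q \<and> restrict x T \<in> R} *
          measure p {x. restrict x Z = z} =
        measure p {x. restrict x Z = z \<and> restrict x S \<in> Q} *
          measure p {x. restrict x Z = z \<and> restrict x T \<in> R})"
      unfolding cond using pos by (simp add: field_simps)
    finally show ?thesis .
  qed
  have null: "measure p {x. restrict x Z = z \<and> P x} = 0"
    if "z \<notin> (\<lambda>x. restrict x Z) ` set_pmf p" for z P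
    using that by (auto simp: measure_pmf_zero_iff)
  show ?thesis
  proof
    assume L: "cond_indep p S T Z"
    show "\<forall>z Q R.
        measure p {x. restrict x Z = z \<and> restrict x S \<in> Q \<and> restrict x T \<in> R} *
          measure p {x. restrict x Z = z} =
        measure p {x. restrict x Z = z \<and> restrict x S \<in> Q} *
          measure p {x. restrict x Z = z \<and> restrict x T \<in> R}"
    proof (intro allI, goal_cases)
      case (1 z Q R)
      show ?case
      proof (cases "z \<in> (\<lambda>x. restrict x Z) ` set_pmf p")
        case True
        then show ?thesis using L main[OF True] unfolding cond_indep_def by blast
      next
        case False
        then show ?thesis by (simp add: null)
      qed
    qed
  next
    assume "\<forall>z Q R.
        measure p {x. restrict x Z = z \<and> restrict x S \<in> Q \<and> restrict x T \<in> R} *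
          measure p {x. restrict x Z = z} =
        measure p {x. restrict x Z = z \<and> restrict x S \<in> Q} *
          measure p {x. restrict x Z = z \<and> restrict x T \<in> R}"
    then show "cond_indep p S T Z"
      unfolding cond_indep_def using main by blast
  qed
qed

lemma cond_indep_sym: "cond_indep p S T Z \<Longrightarrow> cond_indep p T S Z"
  unfolding cond_indep_iff_events by (simp add: conj_commute mult.commute)

lemma cond_indep_if_cond_indep_marginal:
  assumes "cond_indep (map_pmf (\<lambda>x. restrict x W) p) S T Z"
    and "S \<subseteq> W" "T \<subseteq> W" "Z \<subseteq> W"
  shows "cond_indep p S T Z"
proof -
  have "restrict (restrict x W) Y = restrict x Y" if "Y \<subseteq> W" for x :: "'a \<Rightarrow> nat" and Y
    using that by (simp add: Int_absorb1)
  then show ?thesis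
    using assms unfolding cond_indep_iff_events by (simp add: vimage_def)
qed

text \<open>
  Both sides of the product form of conditional independence are sums of \<open>p x * p y\<close> over pairs
  of configurations that take the value \<open>z\<close> on \<open>Z\<close>. On one side \<open>x\<close> alone has to satisfy the
  conditions on \<open>S\<close> and \<open>T\<close>, on the other side \<open>y\<close> satisfies that on \<open>S\<close> and \<open>x\<close> that on
  \<open>T\<close>. Exchanging the coordinates in \<open>U\<close> maps the pairs of one kind to those of the other kind and
  preserves the summand.
\<close>

lemma cond_indep_if_exchangeable:
  assumes "finite \<Omega>" and supp: "set_pmf p \<subseteq> \<Omega>"
    and closed: "\<And>x y. \<lbrakk>x \<in> \<Omega>; y \<in> \<Omega>; restrict x Z = restrict y Z\<rbrakk> \<Longrightarrow> override_on x y U \<in> \<Omega>"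
    and exch: "\<And>x y. \<lbrakk>x \<in> \<Omega>; y \<in> \<Omega>; restrict x Z = restrict y Z\<rbrakk> \<Longrightarrow>
        pmf p (override_on x y U) * pmf p (override_on y x U) = pmf p x * pmf p y"
    and S: "S \<subseteq> U \<union> Z" and T: "T \<inter> U = {}"
  shows "cond_indep p S T Z"
  unfolding cond_indep_iff_events
proof (intro allI)
  fix z Q R
  have m: "measure p {x. P x} = sum (pmf p) {x \<in> \<Omega>. P x}" for P
  proof -
    have "measure p {x. P x} = measure p ({x. P x} \<inter> set_pmf p)"
      by (simp add: measure_Int_set_pmf)
    also have "\<dots> = measure p ({x \<in> \<Omega>. P x} \<inter> set_pmf p)"
      using supp by (intro arg_cong2[where f = measure]) auto
    also have "\<dots> = sum (pmf p) {x \<in> \<Omega>. P x}"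
      using \<open>finite \<Omega>\<close> by (simp add: measure_Int_set_pmf measure_measure_pmf_finite)
    finally show ?thesis .
  qed
  have agreeZ: "restrict (override_on x y U) Z = restrict x Z"
    if "restrict x Z = restrict y Z" for x y :: "'a \<Rightarrow> nat"
    using that by (auto simp: override_on_def restrict_def fun_eq_iff split: if_splits)
  have agreeS: "restrict (override_on x y U) S = restrict y S"
    if "restrict x Z = restrict y Z" for x y :: "'a \<Rightarrow> nat"
    using that S by (auto simp: override_on_def restrict_def fun_eq_iff split: if_splits)
  have agreeT: "restrict (override_on x y U) T = restrict x T" for x y :: "'a \<Rightarrow> nat"
    using T by (auto simp: override_on_def restrict_def fun_eq_iff)
  have invol: "override_on (override_on x y U) (override_on y x U) U = x" for x y :: "'a \<Rightarrow> nat"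
    by (auto simp: override_on_def)
  let ?f = "\<lambda>(x, y). (override_on x y U, override_on y x U)"
  let ?L = "{x \<in> \<Omega>. restrict x Z = z \<and> restrict x S \<in> Q \<and> restrict x T \<in> R} \<times> {x \<in> \<Omega>. restrict x Z = z}"
  let ?R = "{x \<in> \<Omega>. restrict x Z = z \<and> restrict x S \<in> Q} \<times> {x \<in> \<Omega>. restrict x Z = z \<and> restrict x T \<in> R}"
  have "(\<Sum>(x, y)\<in>?L. pmf p x * pmf p y) = (\<Sum>(y, x)\<in>?R. pmf p y * pmf p x)"
  proof (rule sum.reindex_bij_witness[where i = "\<lambda>(y, x). ?f (x, y)" and j = "\<lambda>(x, y). prod.swap (?f (x, y))"])
    fix a assume "a \<in> ?L"
    then obtain x y where a: "a = (x, y)" "x \<in> \<Omega>" "y \<in> \<Omega>" "restrict x Z = restrict y Z"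
        "restrict x Z = z" "restrict x S \<in> Q" "restrict x T \<in> R"
      by auto
    show "(case case a of (x, y) \<Rightarrow> prod.swap (?f (x, y)) of (y, x) \<Rightarrow> ?f (x, y)) = a"
      using a by (simp add: invol)
    show "(case a of (x, y) \<Rightarrow> prod.swap (?f (x, y))) \<in> ?R"
      using a closed[of x y] closed[of y x] by (auto simp: agreeS agreeT agreeZ)
    show "(case case a of (x, y) \<Rightarrow> prod.swap (?f (x, y)) of (y, x) \<Rightarrow> pmf p y * pmf p x) =
        (case a of (x, y) \<Rightarrow> pmf p x * pmf p y)"
      using a exch[of x y] by (simp add: mult.commute)
  next
    fix a assume "a \<in> ?R"
    then obtain x y where a: "a = (y, x)" "x \<in> \<Omega>" "y \<in> \<Omega>" "restrict x Z = restrict y Z"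
        "restrict x Z = z" "restrict y S \<in> Q" "restrict x T \<in> R"
      by auto
    show "(case case a of (y, x) \<Rightarrow> ?f (x, y) of (x, y) \<Rightarrow> prod.swap (?f (x, y))) = a"
      using a by (simp add: invol)
    show "(case a of (y, x) \<Rightarrow> ?f (x, y)) \<in> ?L"
      using a closed[of x y] closed[of y x] by (auto simp: agreeS agreeT agreeZ)
  qed
  then show "measure p {x. restrict x Z = z \<and> restrict x S \<in> Q \<and> restrict x T \<in> R} *
          measure p {x. restrict x Z = z} =
        measure p {x. restrict x Z = z \<and> restrict x S \<in> Q} *
          measure p {x. restrict x Z = z \<and> restrict x T \<in> R}"
    unfolding m by (simp add: sum_product sum.cartesian_product)
qed

text \<open>
  Given the common value on \<open>Z\<close>, the events "the \<open>S\<close>-part is that of \<open>x\<close>" and "the \<open>T\<close>-part is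
  that of \<open>y\<close>" have positive probability, but no configuration of positive probability satisfies
  both.
\<close>

lemma not_cond_indep_if_incompatible:
  assumes x: "x \<in> set_pmf p" and y: "y \<in> set_pmf p" and xy: "restrict x Z = restrict y Z"
    and incompatible: "\<And>w. \<lbrakk>w \<in> set_pmf p; restrict w Z = restrict x Z; restrict w S = restrict x S\<rbrakk>
        \<Longrightarrow> restrict w T \<noteq> restrict y T"
  shows "\<not> cond_indep p S T Z"
proof
  assume "cond_indep p S T Z"
  then have "measure p {w. restrict w Z = restrict x Z \<and> restrict w S \<in> {restrict x S} \<and>
        restrict w T \<in> {restrict y T}} * measure p {w. restrict w Z = restrict x Z} =
      measure p {w. restrict w Z = restrict x Z \<and> restrict w S \<in> {restrict x S}} *
        measure p {w. restrict w Z = restrict x Z \<and> restrict w T \<in> {restrict y T}}"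
    unfolding cond_indep_iff_events by blast
  moreover have "measure p {w. restrict w Z = restrict x Z \<and> restrict w S \<in> {restrict x S} \<and>
        restrict w T \<in> {restrict y T}} = 0"
    using incompatible by (auto simp: measure_pmf_zero_iff)
  moreover have "measure p {w. restrict w Z = restrict x Z \<and> restrict w S \<in> {restrict x S}} \<noteq> 0"
    using x by (auto simp: measure_pmf_zero_iff)
  moreover have "measure p {w. restrict w Z = restrict x Z \<and> restrict w T \<in> {restrict y T}} \<noteq> 0"
    using y xy by (auto simp: measure_pmf_zero_iff)
  ultimately show False
    by simp
qed

lemma override_on_in_PiE:
  "\<lbrakk>x \<in> Pi\<^sub>E V \<X>; y \<in> Pi\<^sub>E V \<X>\<rbrakk> \<Longrightarrow> override_on x y U \<in> Pi\<^sub>E V \<X>"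
  by (auto simp: PiE_iff override_on_def extensional_def)

text \<open>
  This is how a factor that depends on the coordinates in \<open>K\<close> behaves under the exchange of
  coordinates in \<open>U\<close>: in both cases the product of its values at the two configurations
  is preserved.
\<close>

lemma restrict_override_on_keep_or_swap:
  assumes "K \<inter> U = {} \<or> K \<subseteq> U \<union> Z" and "restrict x Z = restrict y Z"
  shows "restrict (override_on x y U) K = restrict x K \<and> restrict (override_on y x U) K = restrict y K \<or>
         restrict (override_on x y U) K = restrict y K \<and> restrict (override_on y x U) K = restrict x K"
proof -
  have agree: "x v = y v" if "v \<in> Z" for v
    using assms(2) that by (metis restrict_apply')
  show ?thesis
    using assms(1)
  proof
    assume "K \<inter> U = {}"
    then have "restrict (override_on x y U) K = restrict x K \<and> restrict (override_on y x U) K = restrict y K"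
      by (auto simp: override_on_def intro!: restrict_ext)
    then show ?thesis ..
  next
    assume "K \<subseteq> U \<union> Z"
    then have "restrict (override_on x y U) K = restrict y K \<and> restrict (override_on y x U) K = restrict x K"
      by (auto simp: override_on_def agree intro!: restrict_ext)
    then show ?thesis ..
  qed
qed


section \<open>Undirected graphs\<close>

text \<open>
  With \<open>U\<close> the set of vertices reached from \<open>S\<close> by paths that avoid \<open>Z\<close>, no edge joins \<open>U\<close> to a vertex
  outside \<open>U \<union> Z\<close>, so a clique that meets \<open>U\<close> is contained in \<open>U \<union> Z\<close>.
\<close>

lemma cond_indep_if_separates:
  assumes "finite_undirected_graph V A" and "S \<subseteq> V" and sep: "separates V A Z S T"
    and fact: "factorizes_undirected V A \<X> p"
  shows "cond_indep p S T Z"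
proof -
  define U where "U = {last vs | vs. graph_path V A vs \<and> path_active Z vs \<and> hd vs \<in> S}"
  have split: "K \<inter> U = {} \<or> K \<subseteq> U \<union> Z" if "clique V A K" for K
  proof (rule disjCI)
    assume "\<not> K \<subseteq> U \<union> Z"
    then obtain w where w: "w \<in> K" "w \<notin> U" "w \<notin> Z"
      by auto
    show "K \<inter> U = {}"
    proof (rule ccontr)
      assume "K \<inter> U \<noteq> {}"
      then obtain vs where vs: "last vs \<in> K" "graph_path V A vs" "path_active Z vs" "hd vs \<in> S"
        by (auto simp: U_def)
      then have "last vs \<noteq> w"
        using w by (auto simp: U_def)
      then have "graph_path V A (vs @ [w])" "path_active Z (vs @ [w])" "hd (vs @ [w]) \<in> S"
        using vs w that by (auto simp: graph_path_def path_active_def clique_def successively_append_iff)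
      then have "last (vs @ [w]) \<in> U"
        unfolding U_def by blast
      then show False
        using w by simp
    qed
  qed
  have fin: "finite (Pi\<^sub>E V \<X>)" and supp: "set_pmf p \<subseteq> Pi\<^sub>E V \<X>"
    using fact assms(1)
    by (auto simp: factorizes_undirected_def distribution_on_def finite_undirected_graph_def intro!: finite_PiE)
  obtain \<C> \<psi> and c :: real where \<C>: "\<And>K. K \<in> \<C> \<Longrightarrow> clique V A K"
    and p: "\<And>x. x \<in> Pi\<^sub>E V \<X> \<Longrightarrow> pmf p x = 1 / c * (\<Prod>K\<in>\<C>. \<psi> K (restrict x K))"
    using fact unfolding factorizes_undirected_def by metis
  show ?thesis
  proof (rule cond_indep_if_exchangeable[OF fin supp override_on_in_PiE])
    fix x y assume x: "x \<in> Pi\<^sub>E V \<X>" and y: "y \<in> Pi\<^sub>E V \<X>" and xy: "restrict x Z = restrict y Z"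
    have "(\<Prod>K\<in>\<C>. \<psi> K (restrict (override_on x y U) K)) * (\<Prod>K\<in>\<C>. \<psi> K (restrict (override_on y x U) K)) =
        (\<Prod>K\<in>\<C>. \<psi> K (restrict x K)) * (\<Prod>K\<in>\<C>. \<psi> K (restrict y K))"
      unfolding prod.distrib[symmetric]
    proof (rule prod.cong[OF refl])
      fix K assume "K \<in> \<C>"
      then show "\<psi> K (restrict (override_on x y U) K) * \<psi> K (restrict (override_on y x U) K) =
          \<psi> K (restrict x K) * \<psi> K (restrict y K)"
        using restrict_override_on_keep_or_swap[OF split[OF \<C>] xy, of K] by auto
    qed
    then show "pmf p (override_on x y U) * pmf p (override_on y x U) = pmf p x * pmf p y"
      using x y by (simp add: p override_on_in_PiE)
  next
    show "S \<subseteq> U \<union> Z"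
    proof
      fix s assume "s \<in> S"
      show "s \<in> U \<union> Z"
      proof (cases "s \<in> Z")
        case False
        then have "graph_path V A [s]" "path_active Z [s]" "hd [s] \<in> S"
          using \<open>s \<in> S\<close> \<open>S \<subseteq> V\<close> by (auto simp: graph_path_def path_active_def)
        then have "last [s] \<in> U"
          unfolding U_def by blast
        then show ?thesis by simp
      qed simp
    qed
    show "T \<inter> U = {}"
      using sep by (auto simp: separates_def U_def)
  qed auto
qed

lemma successively_eq_imp_eq_hd:
  "\<lbrakk>successively (\<lambda>u v. f u = f v) vs; v \<in> set vs\<rbrakk> \<Longrightarrow> f v = f (hd vs)"
  by (induction vs rule: induct_list012) auto

text \<open>
  The counterexample is a fair coin shown at all vertices of an active path, with the constant \<open>0\<close>
  elsewhere. The path avoids \<open>Z\<close>, so nothing is revealed on \<open>Z\<close>. The two possible configurations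
  are characterized by their restrictions to single vertices and edges, which are cliques; this
  makes the distribution factorize.
\<close>

lemma dependent_if_not_separates:
  assumes G: "finite_undirected_graph V A" and not_sep: "\<not> separates V A Z S T"
  shows "\<exists>\<X> p. factorizes_undirected V A \<X> p \<and> \<not> cond_indep p S T Z"
proof -
  obtain vs where path: "graph_path V A vs" and active: "path_active Z vs"
    and ends: "hd vs \<in> S" "last vs \<in> T"
    using not_sep by (auto simp: separates_def)
  have vs: "vs \<noteq> []" "set vs \<subseteq> V" "successively (\<lambda>u v. (u, v) \<in> A) vs" "set vs \<inter> Z = {}"
    using path active by (auto simp: graph_path_def path_active_def)
  define x0 :: "'a \<Rightarrow> nat" where "x0 = (\<lambda>v\<in>V. 0)"
  define x1 :: "'a \<Rightarrow> nat" where "x1 = (\<lambda>v\<in>V. if v \<in> set vs then 1 else 0)"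
  define \<X> :: "'a \<Rightarrow> nat set" where "\<X> = (\<lambda>v. {0, 1})"
  define p where "p = pmf_of_set {x0, x1}"
  define \<psi> :: "'a set \<Rightarrow> ('a \<Rightarrow> nat) \<Rightarrow> real"
    where "\<psi> = (\<lambda>K y. of_bool (y = restrict x0 K \<or> y = restrict x1 K))"
  have fin: "finite V" and symA: "sym A"
    using G by (auto simp: finite_undirected_graph_def)
  have distinct: "x0 \<noteq> x1"
  proof -
    have "x0 (hd vs) \<noteq> x1 (hd vs)"
      using vs(2) hd_in_set[OF vs(1)] by (auto simp: x0_def x1_def)
    then show ?thesis by auto
  qed
  have "distribution_on V \<X> p"
    by (auto simp: distribution_on_def p_def \<X>_def x0_def x1_def)
  moreover have "pmf p x = 1 / 2 * (\<Prod>K | clique V A K. \<psi> K (restrict x K))" if x: "x \<in> Pi\<^sub>E V \<X>" for x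
  proof (cases "x = x0 \<or> x = x1")
    case True
    then show ?thesis
      using distinct by (auto simp: p_def pmf_of_set \<psi>_def)
  next
    case False
    have "finite {K. clique V A K}"
      by (rule finite_subset[of _ "Pow V"]) (auto simp: fin clique_def)
    moreover have "\<exists>K. clique V A K \<and> \<psi> K (restrict x K) = 0"
    proof (rule ccontr)
      assume "\<not> ?thesis"
      then have loc: "restrict x K = restrict x0 K \<or> restrict x K = restrict x1 K" if "clique V A K" for K
        using that by (auto simp: \<psi>_def)
      have off: "x v = 0" if "v \<in> V - set vs" for v
        using that loc[of "{v}"] by (auto simp: clique_def x0_def x1_def restrict_def fun_eq_iff split: if_splits)
      have edge: "x u = x w" if "u \<in> set vs" "w \<in> set vs" "(u, w) \<in> A" for u w
      proof -
        have "clique V A {u, w}"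
          using that vs symA by (auto simp: clique_def dest: symD)
        then have "restrict x {u, w} = restrict x0 {u, w} \<or> restrict x {u, w} = restrict x1 {u, w}"
          by (rule loc)
        then have "(x u = x0 u \<and> x w = x0 w) \<or> (x u = x1 u \<and> x w = x1 w)"
          by (metis insertCI restrict_apply')
        then show ?thesis
          using that vs by (auto simp: x0_def x1_def)
      qed
      have "successively (\<lambda>u v. x u = x v) vs"
        using vs(3) by (rule successively_mono) (auto intro: edge)
      then have const: "x v = x (hd vs)" if "v \<in> set vs" for v
        using that by (rule successively_eq_imp_eq_hd)
      have "hd vs \<in> V"
        using vs(2) hd_in_set[OF vs(1)] by blast
      then have "x (hd vs) \<in> \<X> (hd vs)"
        by (rule PiE_mem[OF x])
      then have "x (hd vs) = 0 \<or> x (hd vs) = 1"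
        by (simp add: \<X>_def)
      moreover have "x = x0" if "x (hd vs) = 0"
      proof
        fix v show "x v = x0 v"
          using that off[of v] const[of v] PiE_arb[OF x, of v] by (cases "v \<in> V"; cases "v \<in> set vs") (auto simp: x0_def)
      qed
      moreover have "x = x1" if "x (hd vs) = 1"
      proof
        fix v show "x v = x1 v"
          using that vs(2) off[of v] const[of v] PiE_arb[OF x, of v] by (cases "v \<in> V"; cases "v \<in> set vs") (auto simp: x1_def)
      qed
      ultimately show False
        using False by blast
    qed
    ultimately have "(\<Prod>K | clique V A K. \<psi> K (restrict x K)) = 0"
      by (intro prod_zero) auto
    then show ?thesis
      using False by (simp add: p_def pmf_of_set)
  qed
  ultimately have "factorizes_undirected V A \<X> p"
    unfolding factorizes_undirected_def
    by (intro conjI exI[of _ "{K. clique V A K}"] exI[of _ \<psi>] exI[of _ 2]) (auto simp: \<psi>_def)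
  moreover have "\<not> cond_indep p S T Z"
  proof (rule not_cond_indep_if_incompatible[of x0 _ x1])
    show "restrict x0 Z = restrict x1 Z"
      using vs by (auto simp: x0_def x1_def restrict_def fun_eq_iff)
    fix w assume "w \<in> set_pmf p" and wS: "restrict w S = restrict x0 S"
    then have "w = x0 \<or> w = x1"
      by (auto simp: p_def)
    moreover have "w (hd vs) = x0 (hd vs)"
      using wS ends by (metis restrict_apply')
    moreover have hl: "hd vs \<in> set vs" "hd vs \<in> V" "last vs \<in> set vs" "last vs \<in> V"
      using vs hd_in_set[of vs] last_in_set[of vs] by auto
    ultimately have "w = x0"
      by (auto simp: x0_def x1_def)
    then have "w (last vs) \<noteq> x1 (last vs)"
      using hl by (auto simp: x0_def x1_def)
    then show "restrict w T \<noteq> restrict x1 T"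
      using ends by (metis restrict_apply')
  qed (auto simp: p_def)
  ultimately show ?thesis by blast
qed


section \<open>Bayesian networks\<close>

text \<open>
  Summing out a sink \<open>v\<close> removes exactly its own factor, because \<open>x v\<close> occurs in no other
  factor and the weights of \<open>v\<close> sum to \<open>1\<close>. As \<open>W\<close> contains the parents of its elements, a vertex outside
  \<open>W\<close> that has no child outside \<open>W\<close> is such a sink, and one can go down from \<open>V\<close> to
  \<open>W\<close> one sink at a time. With \<open>W = {}\<close> this says that the total weight is \<open>1\<close>.
\<close>

lemma sum_bayes_weights_marginal:
  fixes k :: "'v \<Rightarrow> ('v \<Rightarrow> nat) \<Rightarrow> nat \<Rightarrow> real"
  assumes G: "finite_acyclic_digraph V A"
    and fin: "\<And>v. v \<in> V \<Longrightarrow> finite (\<X> v)"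
    and norm: "\<And>v y. \<lbrakk>v \<in> V; y \<in> Pi\<^sub>E (parents A v) \<X>\<rbrakk> \<Longrightarrow> (\<Sum>a\<in>\<X> v. k v y a) = 1"
    and W: "W \<subseteq> V" "\<And>v. v \<in> W \<Longrightarrow> parents A v \<subseteq> W"
    and y: "y \<in> Pi\<^sub>E W \<X>"
  shows "(\<Sum>x | x \<in> Pi\<^sub>E V \<X> \<and> restrict x W = y. \<Prod>v\<in>V. k v (restrict x (parents A v)) (x v)) =
         (\<Prod>v\<in>W. k v (restrict y (parents A v)) (y v))"
proof -
  let ?g = "\<lambda>x v. k v (restrict x (parents A v)) (x v)"
  have A: "finite V" "A \<subseteq> V \<times> V" "acyclic A"
    using G by (auto simp: finite_acyclic_digraph_def)
  then have "finite A"
    by (meson finite_SigmaI finite_subset)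
  then have wf: "wf (A\<inverse>)"
    using A by (simp add: finite_acyclic_wf_converse)
  have "(\<Sum>x | x \<in> Pi\<^sub>E D \<X> \<and> restrict x W = y. \<Prod>v\<in>D. ?g x v) = (\<Prod>v\<in>W. ?g y v)"
    if "W \<subseteq> D" "D \<subseteq> V" "\<And>v. v \<in> D \<Longrightarrow> parents A v \<subseteq> D" for D
    using that
  proof (induction "card (D - W)" arbitrary: D)
    case 0
    have "finite (D - W)"
      using "0.prems" A by (meson Diff_subset finite_subset)
    then have "D = W"
      using 0 by auto
    have single: "{x. x \<in> Pi\<^sub>E W \<X> \<and> restrict x W = y} = {y}"
      using y by (auto simp: PiE_restrict)
    show ?case
      unfolding \<open>D = W\<close> single by simp
  next
    case (Suc m)
    have "D - W \<noteq> {}"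
    proof
      assume "D - W = {}"
      then have "card (D - W) = 0" by (simp only: card.empty)
      then show False using Suc.hyps(2) by simp
    qed
    then obtain v where v: "v \<in> D - W" and sink: "\<And>u. u \<in> D - W \<Longrightarrow> (v, u) \<notin> A"
      using wf unfolding wf_eq_minimal by (metis converse_iff ex_in_conv)
    define D' where "D' = D - {v}"
    have D': "D = insert v D'" "v \<notin> D'" "W \<subseteq> D'" "D' \<subseteq> V" "finite D'" "v \<in> V"
      using v Suc.prems A by (auto simp: D'_def intro: finite_subset)
    have closed: "parents A u \<subseteq> D'" if "u \<in> D'" for u
    proof -
      have "v \<notin> parents A u"
        using that sink W v by (cases "u \<in> W") (auto simp: parents_def D'_def)
      then show ?thesis
        using Suc.prems(3)[of u] that by (auto simp: D'_def)
    qed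
    have "v \<notin> parents A v"
      using A by (auto simp: parents_def acyclic_def)
    then have pv: "parents A v \<subseteq> D'"
      using Suc.prems(3)[of v] v by (auto simp: D'_def)
    have "(\<Sum>x | x \<in> Pi\<^sub>E D \<X> \<and> restrict x W = y. \<Prod>u\<in>D. ?g x u) =
        (\<Sum>(x, a)\<in>{x. x \<in> Pi\<^sub>E D' \<X> \<and> restrict x W = y} \<times> \<X> v.
          (\<Prod>u\<in>D'. ?g x u) * k v (restrict x (parents A v)) a)"
    proof (rule sum.reindex_bij_witness[where i = "\<lambda>(x, a). x(v := a)" and j = "\<lambda>x. (restrict x D', x v)"])
      fix x assume x: "x \<in> {x. x \<in> Pi\<^sub>E D \<X> \<and> restrict x W = y}"
      show "(case (restrict x D', x v) of (x, a) \<Rightarrow> x(v := a)) = x"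
      proof -
        have "x u = undefined" if "u \<notin> D" for u
          using x that by (auto intro: PiE_arb)
        then show ?thesis
          using D' by (auto simp: fun_eq_iff)
      qed
      show "(restrict x D', x v) \<in> {x. x \<in> Pi\<^sub>E D' \<X> \<and> restrict x W = y} \<times> \<X> v"
        using x D' by (auto simp: PiE_iff Int_absorb1)
      have "restrict (restrict x D') (parents A u) = restrict x (parents A u)" if "u \<in> D" for u
        using that closed pv D' by (auto simp: Int_absorb1)
      then show "(case (restrict x D', x v) of
          (x, a) \<Rightarrow> (\<Prod>u\<in>D'. ?g x u) * k v (restrict x (parents A v)) a) = (\<Prod>u\<in>D. ?g x u)"
        using D' by (simp add: mult.commute)
    next
      fix b assume "b \<in> {x. x \<in> Pi\<^sub>E D' \<X> \<and> restrict x W = y} \<times> \<X> v"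
      then obtain x a where b: "b = (x, a)" "x \<in> Pi\<^sub>E D' \<X>" "restrict x W = y" "a \<in> \<X> v"
        by auto
      show "(restrict (case b of (x, a) \<Rightarrow> x(v := a)) D', (case b of (x, a) \<Rightarrow> x(v := a)) v) = b"
      proof -
        have "x u = undefined" if "u \<notin> D'" for u
          using b(2) that by (rule PiE_arb)
        then show ?thesis
          using b D' by (auto simp: fun_eq_iff)
      qed
      have "restrict (x(v := a)) W = restrict x W"
        using v by (auto intro: restrict_ext)
      then show "(case b of (x, a) \<Rightarrow> x(v := a)) \<in> {x. x \<in> Pi\<^sub>E D \<X> \<and> restrict x W = y}"
        using b D' by (auto simp: PiE_iff extensional_def)
    qed
    also have "\<dots> = (\<Sum>x | x \<in> Pi\<^sub>E D' \<X> \<and> restrict x W = y.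
        (\<Prod>u\<in>D'. ?g x u) * (\<Sum>a\<in>\<X> v. k v (restrict x (parents A v)) a))"
      by (simp add: sum.cartesian_product[symmetric] sum_distrib_left)
    also have "\<dots> = (\<Sum>x | x \<in> Pi\<^sub>E D' \<X> \<and> restrict x W = y. \<Prod>u\<in>D'. ?g x u)"
    proof (rule sum.cong[OF refl])
      fix x assume "x \<in> {x. x \<in> Pi\<^sub>E D' \<X> \<and> restrict x W = y}"
      then have "restrict x (parents A v) \<in> Pi\<^sub>E (parents A v) \<X>"
        using pv by (auto simp: PiE_iff)
      then show "(\<Prod>u\<in>D'. ?g x u) * (\<Sum>a\<in>\<X> v. k v (restrict x (parents A v)) a) = (\<Prod>u\<in>D'. ?g x u)"
        using norm[OF \<open>v \<in> V\<close>] by simp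
    qed
    also have "\<dots> = (\<Prod>v\<in>W. ?g y v)"
    proof (rule Suc.hyps(1))
      have "D' - W = (D - W) - {v}"
        by (auto simp: D'_def)
      then show "m = card (D' - W)"
        using Suc.hyps(2) v by simp
    qed (use D' closed in auto)
    finally show ?case .
  qed
  then show ?thesis
    using W A by (auto simp: parents_def)
qed

lemma pmf_marginal_of_factorizes_directed:
  assumes G: "finite_acyclic_digraph V A" and "distribution_on V \<X> p"
    and \<kappa>: "\<And>v y. \<lbrakk>v \<in> V; y \<in> Pi\<^sub>E (parents A v) \<X>\<rbrakk> \<Longrightarrow> set_pmf (\<kappa> v y) \<subseteq> \<X> v"
    and p: "\<And>x. x \<in> Pi\<^sub>E V \<X> \<Longrightarrow> pmf p x = (\<Prod>v\<in>V. pmf (\<kappa> v (restrict x (parents A v))) (x v))"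
    and W: "W \<subseteq> V" "\<And>v. v \<in> W \<Longrightarrow> parents A v \<subseteq> W"
    and y: "y \<in> Pi\<^sub>E W \<X>"
  shows "pmf (map_pmf (\<lambda>x. restrict x W) p) y = (\<Prod>v\<in>W. pmf (\<kappa> v (restrict y (parents A v))) (y v))"
proof -
  have fin\<X>: "\<And>v. v \<in> V \<Longrightarrow> finite (\<X> v)" and supp: "set_pmf p \<subseteq> Pi\<^sub>E V \<X>"
    using assms(2) by (auto simp: distribution_on_def)
  have finV: "finite (Pi\<^sub>E V \<X>)"
    using G fin\<X> by (auto simp: finite_acyclic_digraph_def intro!: finite_PiE)
  let ?Y = "{x. x \<in> Pi\<^sub>E V \<X> \<and> restrict x W = y}"
  have "pmf (map_pmf (\<lambda>x. restrict x W) p) y = measure p ((\<lambda>x. restrict x W) -` {y} \<inter> set_pmf p)"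
    by (simp add: pmf_map measure_Int_set_pmf)
  also have "\<dots> = measure p (?Y \<inter> set_pmf p)"
    using supp by (intro arg_cong2[where f = measure]) auto
  also have "\<dots> = sum (pmf p) ?Y"
    using finV by (simp add: measure_Int_set_pmf measure_measure_pmf_finite)
  also have "\<dots> = (\<Sum>x\<in>?Y. \<Prod>v\<in>V. pmf (\<kappa> v (restrict x (parents A v))) (x v))"
    by (intro sum.cong) (auto simp: p)
  also have "\<dots> = (\<Prod>v\<in>W. pmf (\<kappa> v (restrict y (parents A v))) (y v))"
    using G fin\<X> W y
    by (intro sum_bayes_weights_marginal[where k = "\<lambda>v y. pmf (\<kappa> v y)"]) (auto intro!: sum_pmf_eq_1 dest: \<kappa>)
  finally show ?thesis .
qed

text \<open>
  A directed factorization may be prescribed through the supports of its kernels alone: take the uniform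
  distribution on the values that \<open>R\<close> allows to \<open>v\<close>.
\<close>

lemma ex_factorizes_directed_with_support:
  fixes R :: "'v \<Rightarrow> ('v \<Rightarrow> nat) \<Rightarrow> nat set"
  assumes G: "finite_acyclic_digraph V A"
    and fin: "\<And>v. v \<in> V \<Longrightarrow> finite (\<X> v)"
    and R: "\<And>v y. \<lbrakk>v \<in> V; y \<in> Pi\<^sub>E (parents A v) \<X>\<rbrakk> \<Longrightarrow> R v y \<noteq> {} \<and> R v y \<subseteq> \<X> v"
  shows "\<exists>p. factorizes_directed V A \<X> p \<and>
           set_pmf p = {x \<in> Pi\<^sub>E V \<X>. \<forall>v\<in>V. x v \<in> R v (restrict x (parents A v))}"
proof -
  define \<kappa> where "\<kappa> = (\<lambda>v y. pmf_of_set (R v y))"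
  define f where "f x = (if x \<in> Pi\<^sub>E V \<X> then \<Prod>v\<in>V. pmf (\<kappa> v (restrict x (parents A v))) (x v) else 0)" for x
  have A: "finite V" "A \<subseteq> V \<times> V"
    using G by (auto simp: finite_acyclic_digraph_def)
  have finR: "finite (R v y)" if "v \<in> V" "y \<in> Pi\<^sub>E (parents A v) \<X>" for v y
    using R fin that by (meson finite_subset)
  have \<kappa>: "set_pmf (\<kappa> v y) = R v y" if "v \<in> V" "y \<in> Pi\<^sub>E (parents A v) \<X>" for v y
    using R[OF that] finR[OF that] by (simp add: \<kappa>_def)
  then have \<kappa>_sub: "set_pmf (\<kappa> v y) \<subseteq> \<X> v" if "v \<in> V" "y \<in> Pi\<^sub>E (parents A v) \<X>" for v y
    using R[OF that] that by simp
  have finV: "finite (Pi\<^sub>E V \<X>)"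
    using A fin by (auto intro!: finite_PiE)
  have nonneg: "0 \<le> f x" for x
    by (auto simp: f_def intro!: prod_nonneg)
  \<comment> \<open>The marginal on the empty set of vertices is the total mass.\<close>
  have "(\<Sum>x | x \<in> Pi\<^sub>E V \<X> \<and> restrict x {} = (\<lambda>_. undefined).
           \<Prod>v\<in>V. pmf (\<kappa> v (restrict x (parents A v))) (x v)) =
        (\<Prod>v\<in>{}. pmf (\<kappa> v (restrict (\<lambda>_. undefined) (parents A v))) undefined)"
    using G fin \<kappa>_sub
    by (intro sum_bayes_weights_marginal[where k = "\<lambda>v y. pmf (\<kappa> v y)"]) (auto intro!: sum_pmf_eq_1)
  then have "(\<Sum>x\<in>Pi\<^sub>E V \<X>. f x) = 1"
    by (simp add: f_def restrict_def)
  moreover have "(\<integral>\<^sup>+x. ennreal (f x) \<partial>count_space UNIV) = (\<Sum>x\<in>Pi\<^sub>E V \<X>. ennreal (f x))"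
    using finV by (intro nn_integral_count_space') (auto simp: f_def)
  ultimately have "(\<integral>\<^sup>+x. ennreal (f x) \<partial>count_space UNIV) = 1"
    using nonneg by (simp add: sum_ennreal)
  then have pmf: "pmf (embed_pmf f) x = f x" and set: "set_pmf (embed_pmf f) = {x. f x \<noteq> 0}" for x
    using nonneg by (auto simp: pmf_embed_pmf set_embed_pmf)
  have par: "restrict x (parents A v) \<in> Pi\<^sub>E (parents A v) \<X>" if "x \<in> Pi\<^sub>E V \<X>" for x v
    using that A by (auto simp: parents_def PiE_iff)
  have "set_pmf (embed_pmf f) = {x \<in> Pi\<^sub>E V \<X>. \<forall>v\<in>V. x v \<in> R v (restrict x (parents A v))}"
    using par A by (auto simp: set f_def pmf_eq_0_set_pmf \<kappa>)
  moreover have "factorizes_directed V A \<X> (embed_pmf f)"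
    unfolding factorizes_directed_def distribution_on_def
    using fin \<kappa>_sub by (intro conjI exI[of _ \<kappa>] ballI) (auto simp: set pmf f_def split: if_splits)
  ultimately show ?thesis by blast
qed


section \<open>Trails\<close>

abbreviation active_trail :: "'v set \<Rightarrow> 'v rel \<Rightarrow> 'v set \<Rightarrow> 'v list \<Rightarrow> bool" where
  "active_trail V A Z vs \<equiv> trail V A vs \<and> trail_active A Z vs"

lemma v_structure_append_left:
  "i < length xs \<Longrightarrow> v_structure A (xs @ u # ys) i \<longleftrightarrow> v_structure A (xs @ [u]) i"
  by (auto simp: v_structure_def nth_append nth_Cons split: nat.splits)

lemma v_structure_append_right:
  "0 < j \<Longrightarrow> v_structure A (xs @ u # ys) (length xs + j) \<longleftrightarrow> v_structure A (u # ys) j"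
  by (cases j) (auto simp: v_structure_def nth_append)

lemma v_structure_junction:
  "v_structure A (xs @ u # ys) (length xs) \<longleftrightarrow>
     xs \<noteq> [] \<and> ys \<noteq> [] \<and> (last xs, u) \<in> A \<and> (hd ys, u) \<in> A"
  by (auto simp: v_structure_def nth_append last_conv_nth hd_conv_nth)

text \<open>
  The activity of a trail is split into conditions on its positions, because these are local: when two
  trails are joined, only the condition at the junction changes.
\<close>

definition active_at :: "'v rel \<Rightarrow> 'v set \<Rightarrow> 'v list \<Rightarrow> nat \<Rightarrow> bool" where
  "active_at A Z vs i \<longleftrightarrow>
     (if v_structure A vs i then descendants A (vs ! i) \<inter> Z \<noteq> {} else vs ! i \<notin> Z)"

lemma trail_active_iff_active_at: "trail_active A Z vs \<longleftrightarrow> (\<forall>i<length vs. active_at A Z vs i)"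
  by (simp add: trail_active_def active_at_def)

lemma active_at_append_left:
  "i < length xs \<Longrightarrow> active_at A Z (xs @ u # ys) i \<longleftrightarrow> active_at A Z (xs @ [u]) i"
  using v_structure_append_left[of i xs A u ys] by (simp add: active_at_def nth_append)

lemma active_at_append_right:
  "0 < j \<Longrightarrow> active_at A Z (xs @ u # ys) (length xs + j) \<longleftrightarrow> active_at A Z (u # ys) j"
  by (simp add: active_at_def v_structure_append_right nth_append)

lemma active_at_junction:
  "active_at A Z (xs @ u # ys) (length xs) \<longleftrightarrow>
     (if xs \<noteq> [] \<and> ys \<noteq> [] \<and> (last xs, u) \<in> A \<and> (hd ys, u) \<in> A
      then descendants A u \<inter> Z \<noteq> {} else u \<notin> Z)"
  unfolding active_at_def v_structure_junction by simp

lemma trail_active_append_iff: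
  "trail_active A Z (xs @ u # ys) \<longleftrightarrow>
     (\<forall>i<length xs. active_at A Z (xs @ [u]) i) \<and> active_at A Z (xs @ u # ys) (length xs) \<and>
     (\<forall>j. 0 < j \<and> j < length (u # ys) \<longrightarrow> active_at A Z (u # ys) j)"
    (is "?L \<longleftrightarrow> ?R")
proof
  assume ?L
  then have ok: "active_at A Z (xs @ u # ys) i" if "i < length (xs @ u # ys)" for i
    using that unfolding trail_active_iff_active_at by blast
  have "active_at A Z (xs @ [u]) i" if "i < length xs" for i
    using ok[of i] that active_at_append_left[of i xs A Z u ys] by simp
  moreover have "active_at A Z (u # ys) j" if "0 < j" "j < length (u # ys)" for j
    using ok[of "length xs + j"] that by (simp add: active_at_append_right)
  ultimately show ?R
    using ok[of "length xs"] by simp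
next
  assume R: ?R
  show ?L
    unfolding trail_active_iff_active_at
  proof (intro allI impI)
    fix i assume i: "i < length (xs @ u # ys)"
    consider "i < length xs" | "i = length xs" | "i > length xs" by linarith
    then show "active_at A Z (xs @ u # ys) i"
    proof cases
      case 3
      then show ?thesis
        using R i active_at_append_right[of "i - length xs" A Z xs u ys] by simp
    qed (use R active_at_append_left[of i xs A Z u ys] in simp_all)
  qed
qed

lemma trail_active_snoc_iff:
  "trail_active A Z (xs @ [u]) \<longleftrightarrow> (\<forall>i<length xs. active_at A Z (xs @ [u]) i) \<and> u \<notin> Z"
  by (simp add: trail_active_append_iff active_at_junction)

lemma trail_active_Cons_iff:
  "trail_active A Z (u # ys) \<longleftrightarrow> u \<notin> Z \<and> (\<forall>j. 0 < j \<and> j < length (u # ys) \<longrightarrow> active_at A Z (u # ys) j)"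
  using trail_active_append_iff[of A Z "[]" u ys] active_at_junction[of A Z "[]" u ys] by simp

lemma hd_notin_if_trail_active: "trail_active A Z (u # ys) \<Longrightarrow> u \<notin> Z"
  by (simp add: trail_active_Cons_iff)

text \<open>
  As an end of both trails, \<open>u\<close> lies outside \<open>Z\<close>; the junction can therefore block the joined trail only
  if it becomes a v-structure.
\<close>

lemma active_trail_glue:
  assumes "active_trail V A Z (xs @ [u])" "active_trail V A Z (u # ys)"
    and "\<lbrakk>xs \<noteq> []; ys \<noteq> []; (last xs, u) \<in> A; (hd ys, u) \<in> A\<rbrakk> \<Longrightarrow> descendants A u \<inter> Z \<noteq> {}"
  shows "active_trail V A Z (xs @ u # ys)"
proof
  show "trail V A (xs @ u # ys)"
    using assms(1,2) by (auto simp: trail_def successively_append_iff successively_Cons)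
  have "active_at A Z (xs @ u # ys) (length xs)"
    using assms by (simp add: active_at_junction trail_active_snoc_iff)
  then show "trail_active A Z (xs @ u # ys)"
    using assms(1,2) unfolding trail_active_append_iff trail_active_snoc_iff trail_active_Cons_iff
    by blast
qed

lemma active_trail_suffix:
  assumes "active_trail V A Z (xs @ u # ys)" and "u \<notin> Z"
  shows "active_trail V A Z (u # ys)"
proof
  show "trail V A (u # ys)"
    using assms by (auto simp: trail_def successively_append_iff)
  show "trail_active A Z (u # ys)"
    using assms unfolding trail_active_append_iff trail_active_Cons_iff by blast
qed

lemma active_trail_single: "\<lbrakk>u \<in> V; u \<notin> Z\<rbrakk> \<Longrightarrow> active_trail V A Z [u]"
  by (auto simp: trail_def trail_active_def v_structure_def)

lemma active_trail_edge:
  "\<lbrakk>(u, w) \<in> A \<or> (w, u) \<in> A; u \<in> V; w \<in> V; u \<notin> Z; w \<notin> Z\<rbrakk> \<Longrightarrow> active_trail V A Z [u, w]"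
  by (auto simp: trail_def trail_active_def v_structure_def less_Suc_eq)

lemma active_trail_collider:
  "\<lbrakk>(u, c) \<in> A; (w, c) \<in> A; u \<in> V; w \<in> V; c \<in> V; u \<notin> Z; w \<notin> Z; descendants A c \<inter> Z \<noteq> {}\<rbrakk>
    \<Longrightarrow> active_trail V A Z [u, c, w]"
  by (auto simp: trail_def trail_active_def v_structure_def less_Suc_eq)

lemma descendants_step: "(c, d) \<in> A \<Longrightarrow> descendants A d \<subseteq> descendants A c"
  by (auto simp: descendants_def)

lemma acyclic_no_2_cycle: "\<lbrakk>acyclic A; (u, w) \<in> A\<rbrakk> \<Longrightarrow> (w, u) \<notin> A"
  by (meson acyclic_def trancl.r_into_trancl trancl_into_trancl)

text \<open>
  If \<open>c\<close> has no descendant in \<open>Z\<close>, then all vertices of a directed path from \<open>c\<close> are outside \<open>Z\<close>, and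
  such a path has no v-structure. The first arrow leaves \<open>c\<close>, so that \<open>c\<close> does not become a
  v-structure when another trail ending in \<open>c\<close> is continued by this one.
\<close>

lemma active_trail_to_descendant:
  assumes G: "finite_acyclic_digraph V A" and ct: "(c, t) \<in> A\<^sup>*" and "c \<in> V" "descendants A c \<inter> Z = {}"
  shows "\<exists>ys. active_trail V A Z (c # ys) \<and> last (c # ys) = t \<and> (ys = [] \<or> (c, hd ys) \<in> A)"
  using ct assms(3,4)
proof (induction rule: converse_rtrancl_induct)
  case base
  then have "t \<notin> Z" by (auto simp: descendants_def)
  then show ?case using active_trail_single[of t V Z A] base by (intro exI[of _ "[]"]) auto
next
  case (step c d)
  have A: "A \<subseteq> V \<times> V" "acyclic A"
    using G by (auto simp: finite_acyclic_digraph_def)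
  have "d \<in> V" "descendants A d \<inter> Z = {}"
    using step A descendants_step[OF step.hyps(1)] by auto
  then obtain ys where ys: "active_trail V A Z (d # ys)" "last (d # ys) = t" "ys = [] \<or> (d, hd ys) \<in> A"
    using step.IH by blast
  have "c \<notin> Z" "d \<notin> Z"
    using step.prems \<open>descendants A d \<inter> Z = {}\<close> by (auto simp: descendants_def)
  then have "active_trail V A Z ([c] @ [d])"
    using active_trail_edge[of c d] step \<open>d \<in> V\<close> by simp
  from this ys(1) have "active_trail V A Z ([c] @ d # ys)"
    by (rule active_trail_glue) (use ys acyclic_no_2_cycle[OF A(2)] in auto)
  then show ?case
    using ys step by (intro exI[of _ "d # ys"]) auto
qed

text \<open>
  The same directed path, walked backwards.
\<close>

lemma active_trail_from_descendant:
  assumes G: "finite_acyclic_digraph V A" and ct: "(c, t) \<in> A\<^sup>*" and "c \<in> V" "descendants A c \<inter> Z = {}"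
  shows "\<exists>xs. active_trail V A Z (xs @ [c]) \<and> hd (xs @ [c]) = t \<and> (xs = [] \<or> (c, last xs) \<in> A)"
  using ct assms(3,4)
proof (induction rule: converse_rtrancl_induct)
  case base
  then have "t \<notin> Z" by (auto simp: descendants_def)
  then show ?case using active_trail_single[of t V Z A] base by (intro exI[of _ "[]"]) auto
next
  case (step c d)
  have A: "A \<subseteq> V \<times> V" "acyclic A"
    using G by (auto simp: finite_acyclic_digraph_def)
  have "d \<in> V" "descendants A d \<inter> Z = {}"
    using step A descendants_step[OF step.hyps(1)] by auto
  then obtain xs where xs: "active_trail V A Z (xs @ [d])" "hd (xs @ [d]) = t" "xs = [] \<or> (d, last xs) \<in> A"
    using step.IH by blast
  have "c \<notin> Z" "d \<notin> Z"
    using step.prems \<open>descendants A d \<inter> Z = {}\<close> by (auto simp: descendants_def)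
  then have "active_trail V A Z (d # [c])"
    using active_trail_edge[of d c] step \<open>d \<in> V\<close> by simp
  from xs(1) this have "active_trail V A Z (xs @ d # [c])"
    by (rule active_trail_glue) (use xs acyclic_no_2_cycle[OF A(2)] in auto)
  then show ?case
    using xs step by (intro exI[of _ "xs @ [d]"]) (auto simp: hd_append)
qed


section \<open>Acyclic directed graphs\<close>

text \<open>
  The set \<open>U\<close> of vertices reached by active trails from \<open>S\<close> does not cut through the family of
  an ancestor \<open>c\<close> of \<open>S \<union> T \<union> Z\<close> except by vertices in \<open>Z\<close>. An active trail can be
  extended from one member of the family to another unless \<open>c\<close> becomes a v-structure without
  descendants in \<open>Z\<close>. In this case \<open>c\<close> has a descendant in \<open>S\<close> or in \<open>T\<close>. From a
  descendant in \<open>S\<close> one can start afresh and arrive at \<open>c\<close> against the arrows, so that \<open>c\<close> is no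
  v-structure. To a descendant in \<open>T\<close> one could continue along the arrows, against d-separation.
\<close>

lemma active_reachability_family_split:
  assumes G: "finite_acyclic_digraph V A" and sep: "d_separates V A Z S T"
    and c: "c \<in> V" "descendants A c \<inter> (S \<union> T \<union> Z) \<noteq> {}"
    and U: "U = {last vs | vs. active_trail V A Z vs \<and> hd vs \<in> S}"
  shows "insert c (parents A c) \<inter> U = {} \<or> insert c (parents A c) \<subseteq> U \<union> Z"
proof -
  have A: "A \<subseteq> V \<times> V" "acyclic A"
    using G by (auto simp: finite_acyclic_digraph_def)
  have U_iff: "u \<in> U \<longleftrightarrow> (\<exists>xs. active_trail V A Z (xs @ [u]) \<and> hd (xs @ [u]) \<in> S)" for u
  proof
    assume "u \<in> U"
    then obtain vs where "u = last vs" "active_trail V A Z vs" "hd vs \<in> S"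
      by (auto simp: U)
    then show "\<exists>xs. active_trail V A Z (xs @ [u]) \<and> hd (xs @ [u]) \<in> S"
      by (intro exI[of _ "butlast vs"]) (auto simp: trail_def)
  next
    assume "\<exists>xs. active_trail V A Z (xs @ [u]) \<and> hd (xs @ [u]) \<in> S"
    then obtain xs where "active_trail V A Z (xs @ [u])" "hd (xs @ [u]) \<in> S"
      by blast
    then have "last (xs @ [u]) \<in> U"
      unfolding U by blast
    then show "u \<in> U" by simp
  qed
  have notZ: "u \<notin> Z" if "u \<in> U" for u
    using that by (auto simp: U_iff trail_active_snoc_iff)
  have extend: "last (u # ys) \<in> U"
    if xs: "active_trail V A Z (xs @ [u])" "hd (xs @ [u]) \<in> S" and ys: "active_trail V A Z (u # ys)"
      and "\<lbrakk>xs \<noteq> []; ys \<noteq> []; (last xs, u) \<in> A; (hd ys, u) \<in> A\<rbrakk> \<Longrightarrow> descendants A u \<inter> Z \<noteq> {}"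
    for xs u ys
  proof -
    have "active_trail V A Z (xs @ u # ys)"
      using xs(1) ys that(4) by (rule active_trail_glue)
    moreover have "hd (xs @ u # ys) = hd (xs @ [u])"
      by (cases xs) auto
    ultimately have "last (xs @ u # ys) \<in> U"
      using xs(2) unfolding U by (intro CollectI exI[of _ "xs @ u # ys"]) auto
    then show ?thesis by simp
  qed
  have down: "c \<in> U" if u: "u \<in> U" "(u, c) \<in> A" and "c \<notin> Z" for u
  proof -
    obtain xs where xs: "active_trail V A Z (xs @ [u])" "hd (xs @ [u]) \<in> S"
      using u(1) unfolding U_iff by blast
    have "active_trail V A Z (u # [c])"
      using that A notZ[OF u(1)] by (intro active_trail_edge) auto
    then have "last (u # [c]) \<in> U"
      using acyclic_no_2_cycle[OF A(2) u(2)] by (intro extend[OF xs]) auto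
    then show ?thesis by simp
  qed
  have up: "w \<in> U" if cU: "c \<in> U" and "(w, c) \<in> A" "w \<notin> Z" for w
  proof -
    obtain xs where xs: "active_trail V A Z (xs @ [c])" "hd (xs @ [c]) \<in> S"
      using cU unfolding U_iff by blast
    have cw: "active_trail V A Z (c # [w])"
      using that A notZ[OF cU] by (intro active_trail_edge) auto
    show ?thesis
    proof (cases "descendants A c \<inter> Z = {}")
      case False
      then show ?thesis
        using extend[OF xs cw] by simp
    next
      case True
      then obtain t where t: "(c, t) \<in> A\<^sup>*" "t \<in> S \<union> T"
        using c by (auto simp: descendants_def)
      then show ?thesis
      proof (cases "t \<in> S")
        case True
        obtain zs where zs: "active_trail V A Z (zs @ [c])" "hd (zs @ [c]) = t" "zs = [] \<or> (c, last zs) \<in> A"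
          using active_trail_from_descendant[OF G t(1) c(1) \<open>descendants A c \<inter> Z = {}\<close>] by blast
        then have "last (c # [w]) \<in> U"
          using True acyclic_no_2_cycle[OF A(2)] by (intro extend[OF zs(1) _ cw]) auto
        then show ?thesis by simp
      next
        case False
        obtain ys where ys: "active_trail V A Z (c # ys)" "last (c # ys) = t" "ys = [] \<or> (c, hd ys) \<in> A"
          using active_trail_to_descendant[OF G t(1) c(1) \<open>descendants A c \<inter> Z = {}\<close>] by blast
        then have "last (c # ys) \<in> U"
          using acyclic_no_2_cycle[OF A(2)] by (intro extend[OF xs]) auto
        then have False
          using sep False t ys(2) by (auto simp: U d_separates_def)
        then show ?thesis ..
      qed
    qed
  qed
  have across: "w \<in> U" if u: "u \<in> U" "(u, c) \<in> A" "(w, c) \<in> A" "w \<notin> Z" for u w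
  proof (cases "c \<in> Z")
    case False
    then show ?thesis
      using that down up by blast
  next
    case True
    obtain xs where xs: "active_trail V A Z (xs @ [u])" "hd (xs @ [u]) \<in> S"
      using u(1) unfolding U_iff by blast
    have "descendants A c \<inter> Z \<noteq> {}"
      using True by (auto simp: descendants_def)
    then have "active_trail V A Z (u # [c, w])"
      using that A notZ[OF u(1)] c by (intro active_trail_collider) auto
    then have "last (u # [c, w]) \<in> U"
      using acyclic_no_2_cycle[OF A(2) u(2)] by (intro extend[OF xs]) auto
    then show ?thesis by simp
  qed
  have "insert c (parents A c) \<subseteq> U \<union> Z" if u: "u \<in> insert c (parents A c)" "u \<in> U" for u
  proof (intro subsetI UnCI)
    fix w assume w: "w \<in> insert c (parents A c)" "w \<notin> Z"
    consider "u = c" "w = c" | "u = c" "(w, c) \<in> A" | "(u, c) \<in> A" "w = c" | "(u, c) \<in> A" "(w, c) \<in> A"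
      using u(1) w(1) by (auto simp: parents_def)
    then show "w \<in> U"
      by cases (use u(2) w(2) down up across in \<open>blast+\<close>)
  qed
  then show ?thesis by blast
qed

text \<open>
  The factors of vertices that are no ancestors of \<open>S \<union> T \<union> Z\<close> may couple \<open>U\<close> with the rest;
  hence the exchange is applied to the marginal on the ancestors, whose factors are
  those of the ancestors.
\<close>

lemma cond_indep_if_d_separates:
  assumes G: "finite_acyclic_digraph V A" and sub: "S \<subseteq> V" "T \<subseteq> V" "Z \<subseteq> V"
    and sep: "d_separates V A Z S T" and fact: "factorizes_directed V A \<X> p"
  shows "cond_indep p S T Z"
proof -
  define W where "W = {v \<in> V. descendants A v \<inter> (S \<union> T \<union> Z) \<noteq> {}}"
  define U where "U = {last vs | vs. active_trail V A Z vs \<and> hd vs \<in> S}"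
  have A: "finite V" "A \<subseteq> V \<times> V"
    using G by (auto simp: finite_acyclic_digraph_def)
  have W: "W \<subseteq> V" "S \<subseteq> W" "T \<subseteq> W" "Z \<subseteq> W"
    using sub by (auto simp: W_def descendants_def)
  have closed: "parents A v \<subseteq> W" if "v \<in> W" for v
    using that A descendants_step[of _ v A] by (fastforce simp: W_def parents_def)
  have dist: "distribution_on V \<X> p"
    using fact by (simp add: factorizes_directed_def)
  obtain \<kappa> where \<kappa>: "\<And>v y. \<lbrakk>v \<in> V; y \<in> Pi\<^sub>E (parents A v) \<X>\<rbrakk> \<Longrightarrow> set_pmf (\<kappa> v y) \<subseteq> \<X> v"
    and p: "\<And>x. x \<in> Pi\<^sub>E V \<X> \<Longrightarrow> pmf p x = (\<Prod>v\<in>V. pmf (\<kappa> v (restrict x (parents A v))) (x v))"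
    using fact unfolding factorizes_directed_def by metis
  let ?q = "map_pmf (\<lambda>x. restrict x W) p"
  have q: "pmf ?q y = (\<Prod>v\<in>W. pmf (\<kappa> v (restrict y (parents A v))) (y v))" if "y \<in> Pi\<^sub>E W \<X>" for y
    by (rule pmf_marginal_of_factorizes_directed[OF G dist \<kappa> p W(1) closed that])
  have "cond_indep ?q S T Z"
  proof (rule cond_indep_if_exchangeable[OF _ _ override_on_in_PiE])
    show "finite (Pi\<^sub>E W \<X>)"
      using dist W A by (auto simp: distribution_on_def intro!: finite_PiE intro: finite_subset)
    have "x v \<in> \<X> v" if "x \<in> set_pmf p" "v \<in> W" for x v
      using that dist W(1) unfolding distribution_on_def by (meson PiE_mem subsetD)
    then show "set_pmf ?q \<subseteq> Pi\<^sub>E W \<X>"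
      by auto
  next
    fix x y assume x: "x \<in> Pi\<^sub>E W \<X>" and y: "y \<in> Pi\<^sub>E W \<X>" and xy: "restrict x Z = restrict y Z"
    let ?g = "\<lambda>x v. pmf (\<kappa> v (restrict x (parents A v))) (x v)"
    \<comment> \<open>The factor of a vertex depends only on the coordinates of its family.\<close>
    have local: "?g x v = ?g (restrict x (insert v (parents A v))) v" for x v
      by (simp add: Int_absorb1 subset_insertI)
    have "(\<Prod>v\<in>W. ?g (override_on x y U) v) * (\<Prod>v\<in>W. ?g (override_on y x U) v) =
        (\<Prod>v\<in>W. ?g x v) * (\<Prod>v\<in>W. ?g y v)"
      unfolding prod.distrib[symmetric]
    proof (rule prod.cong[OF refl])
      fix v assume "v \<in> W"
      then have "insert v (parents A v) \<inter> U = {} \<or> insert v (parents A v) \<subseteq> U \<union> Z"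
        by (intro active_reachability_family_split[OF G sep _ _ U_def]) (auto simp: W_def)
      from restrict_override_on_keep_or_swap[OF this xy]
      show "?g (override_on x y U) v * ?g (override_on y x U) v = ?g x v * ?g y v"
        unfolding local[where x = "override_on x y U"] local[where x = "override_on y x U"] local[where x = x] local[where x = y]
        by (elim disjE conjE) (simp_all only: mult.commute)
    qed
    then show "pmf ?q (override_on x y U) * pmf ?q (override_on y x U) = pmf ?q x * pmf ?q y"
      using x y by (simp only: q override_on_in_PiE)
  next
    show "S \<subseteq> U \<union> Z"
    proof
      fix s assume "s \<in> S"
      show "s \<in> U \<union> Z"
      proof (cases "s \<in> Z")
        case False
        then have "active_trail V A Z [s]"
          using \<open>s \<in> S\<close> sub by (intro active_trail_single) auto
        then have "last [s] \<in> U"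
          using \<open>s \<in> S\<close> unfolding U_def by (intro CollectI exI[of _ "[s]"]) auto
        then show ?thesis by simp
      qed simp
    qed
    show "T \<inter> U = {}"
      using sep by (auto simp: d_separates_def U_def)
  qed auto
  then show ?thesis
    using W(2-4) by (rule cond_indep_if_cond_indep_marginal)
qed


text \<open>
  The variable of a vertex \<open>u\<close> is a set of numbers, encoded as one number. For each position \<open>i\<close> at which
  the trail visits \<open>u\<close> other than as a v-structure (a carrier), membership of \<open>i\<close> is a bit; separate bits for
  separate positions allow the trail to repeat vertices. Membership of \<open>n\<close>, the length of the
  trail, is an error flag. The kernels copy bits along the arrows of the trail and leave
  a bit free at a source of the trail. The error flag is raised at a v-structure whose two neighbours
  disagree, and every vertex inherits it from its parents.

  Carriers are outside \<open>Z\<close>, so on \<open>Z\<close> only error flags can be seen. A v-structure has a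
  descendant in \<open>Z\<close>; if no flag is seen there, the two neighbours of the v-structure agree. Thus
  without flags on \<open>Z\<close> the bits at the two ends of the trail are equal, while both common
  values are possible.
\<close>

lemma dependent_if_not_d_separates:
  assumes G: "finite_acyclic_digraph V A" and not_sep: "\<not> d_separates V A Z S T"
  shows "\<exists>\<X> p. factorizes_directed V A \<X> p \<and> \<not> cond_indep p S T Z"
proof -
  obtain vs where trail: "trail V A vs" and active: "trail_active A Z vs"
    and ends: "hd vs \<in> S" "last vs \<in> T"
    using not_sep by (auto simp: d_separates_def)
  have A: "A \<subseteq> V \<times> V" "acyclic A"
    using G by (auto simp: finite_acyclic_digraph_def)
  define n where "n = length vs"
  have vs: "vs \<noteq> []" "set vs \<subseteq> V"
    using trail by (auto simp: trail_def)
  have "0 < n"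
    using vs by (simp add: n_def)
  have adj: "(vs ! i, vs ! Suc i) \<in> A \<or> (vs ! Suc i, vs ! i) \<in> A" if "Suc i < n" for i
    using trail that by (auto simp: trail_def n_def successively_conv_nth)
  define carrier where "carrier i \<longleftrightarrow> i < n \<and> \<not> v_structure A vs i" for i
  have carrier_notin: "vs ! i \<notin> Z" if "carrier i" for i
    using that active by (auto simp: carrier_def trail_active_def n_def)
  define bit :: "('a \<Rightarrow> nat) \<Rightarrow> nat \<Rightarrow> bool" where "bit x i \<longleftrightarrow> i \<in> set_decode (x (vs ! i))" for x i
  define err :: "('a \<Rightarrow> nat) \<Rightarrow> 'a \<Rightarrow> bool" where "err x u \<longleftrightarrow> n \<in> set_decode (x u)" for x u
  define clash where "clash x u \<longleftrightarrow>
      (\<exists>i. v_structure A vs i \<and> vs ! i = u \<and> bit x (i - 1) \<noteq> bit x (Suc i))" for x u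
  define consistent :: "'a \<Rightarrow> ('a \<Rightarrow> nat) \<Rightarrow> nat set \<Rightarrow> bool" where "consistent u y D \<longleftrightarrow>
      D \<subseteq> {..n} \<and> (\<forall>i\<in>D. i < n \<longrightarrow> carrier i \<and> vs ! i = u) \<and>
      (\<forall>i. carrier i \<and> vs ! i = u \<longrightarrow>
        (0 < i \<and> (vs ! (i - 1), u) \<in> A \<longrightarrow> (i \<in> D \<longleftrightarrow> bit y (i - 1))) \<and>
        (Suc i < n \<and> (vs ! Suc i, u) \<in> A \<longrightarrow> (i \<in> D \<longleftrightarrow> bit y (Suc i)))) \<and>
      (n \<in> D \<longleftrightarrow> clash y u \<or> (\<exists>w\<in>parents A u. err y w))" for u y D
  define \<X> :: "'a \<Rightarrow> nat set" where "\<X> = (\<lambda>v. set_encode ` Pow {..n})"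
  define R where "R u y = set_encode ` {D. consistent u y D}" for u y
  have "R u y \<noteq> {} \<and> R u y \<subseteq> \<X> u" for u y
  proof -
    \<comment> \<open>A carrier is not a v-structure, so at most one of its trail neighbours is a parent to copy from.\<close>
    define D where "D =
      {i. carrier i \<and> vs ! i = u \<and> (0 < i \<and> (vs ! (i - 1), u) \<in> A \<and> bit y (i - 1) \<or>
        Suc i < n \<and> (vs ! Suc i, u) \<in> A \<and> bit y (Suc i))} \<union>
      (if clash y u \<or> (\<exists>w\<in>parents A u. err y w) then {n} else {})"
    have "\<not> (0 < i \<and> (vs ! (i - 1), u) \<in> A \<and> Suc i < n \<and> (vs ! Suc i, u) \<in> A)" if "carrier i" "vs ! i = u" for i
      using that by (auto simp: carrier_def v_structure_def n_def)
    then have "consistent u y D"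
      by (auto simp: consistent_def D_def carrier_def split: if_splits)
    moreover have "R u y \<subseteq> \<X> u"
      by (auto simp: R_def \<X>_def consistent_def)
    ultimately show ?thesis
      by (auto simp: R_def)
  qed
  moreover have "finite (\<X> v)" for v
    by (simp add: \<X>_def)
  ultimately obtain p where p: "factorizes_directed V A \<X> p"
    and supp: "set_pmf p = {x \<in> Pi\<^sub>E V \<X>. \<forall>v\<in>V. x v \<in> R v (restrict x (parents A v))}"
    using ex_factorizes_directed_with_support[OF G, of \<X> R] by blast
  \<comment> \<open>Consistency at a vertex looks only at its parents, as a kernel must.\<close>
  have consistent_restrict: "consistent u (restrict x (parents A u)) D \<longleftrightarrow> consistent u x D" for u x D
  proof -
    have bit: "bit (restrict x (parents A u)) i \<longleftrightarrow> bit x i" if "(vs ! i, u) \<in> A" for i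
      using that by (simp add: bit_def parents_def)
    have nbrs: "(\<forall>i. carrier i \<and> vs ! i = u \<longrightarrow>
        (0 < i \<and> (vs ! (i - 1), u) \<in> A \<longrightarrow> (i \<in> D \<longleftrightarrow> bit (restrict x (parents A u)) (i - 1))) \<and>
        (Suc i < n \<and> (vs ! Suc i, u) \<in> A \<longrightarrow> (i \<in> D \<longleftrightarrow> bit (restrict x (parents A u)) (Suc i)))) \<longleftrightarrow>
      (\<forall>i. carrier i \<and> vs ! i = u \<longrightarrow>
        (0 < i \<and> (vs ! (i - 1), u) \<in> A \<longrightarrow> (i \<in> D \<longleftrightarrow> bit x (i - 1))) \<and>
        (Suc i < n \<and> (vs ! Suc i, u) \<in> A \<longrightarrow> (i \<in> D \<longleftrightarrow> bit x (Suc i))))"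
      using bit by blast
    have clash: "clash (restrict x (parents A u)) u \<longleftrightarrow> clash x u"
      unfolding clash_def v_structure_def using bit by blast
    have err: "(\<exists>w\<in>parents A u. err (restrict x (parents A u)) w) \<longleftrightarrow> (\<exists>w\<in>parents A u. err x w)"
      by (intro bex_cong) (simp_all add: err_def)
    show ?thesis
      unfolding consistent_def nbrs clash err by (rule refl)
  qed
  have supp_iff: "x \<in> set_pmf p \<longleftrightarrow> x \<in> Pi\<^sub>E V \<X> \<and> (\<forall>v\<in>V. consistent v x (set_decode (x v)))" for x
  proof -
    have "x v \<in> R v (restrict x (parents A v)) \<longleftrightarrow> consistent v x (set_decode (x v))" for v
    proof
      assume "x v \<in> R v (restrict x (parents A v))"
      then obtain D where D: "x v = set_encode D" "consistent v x D"
        by (auto simp: R_def consistent_restrict)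
      then have "finite D"
        using finite_subset[of D "{..n}"] by (simp add: consistent_def)
      then show "consistent v x (set_decode (x v))"
        using D by simp
    next
      assume "consistent v x (set_decode (x v))"
      then show "x v \<in> R v (restrict x (parents A v))"
        unfolding R_def consistent_restrict by (metis image_eqI mem_Collect_eq set_decode_inverse)
    qed
    then show ?thesis
      unfolding supp by blast
  qed
  define x0 :: "'a \<Rightarrow> nat" where "x0 = (\<lambda>v\<in>V. 0)"
  define x1 :: "'a \<Rightarrow> nat" where "x1 = (\<lambda>v\<in>V. set_encode {i. carrier i \<and> vs ! i = v})"
  have fin: "finite {i. carrier i \<and> vs ! i = v}" for v
    by (rule finite_subset[of _ "{..n}"]) (auto simp: carrier_def)
  have inV: "vs ! i \<in> V" if "i < n" for i
    using vs that by (auto simp: n_def)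
  have v_struct_nbrs: "0 < i" "Suc i < n" "carrier (i - 1)" "carrier (Suc i)" if "v_structure A vs i" for i
  proof -
    show i: "0 < i" "Suc i < n"
      using that by (auto simp: v_structure_def n_def)
    have "(vs ! (i - 1), vs ! i) \<in> A" "(vs ! Suc i, vs ! i) \<in> A"
      using that by (auto simp: v_structure_def)
    then show "carrier (i - 1)" "carrier (Suc i)"
      using i acyclic_no_2_cycle[OF A(2)] by (auto simp: carrier_def v_structure_def)
  qed
  have bit0: "\<not> bit x0 i" "\<not> err x0 v" if "i < n" "v \<in> V" for i v
    using that inV by (auto simp: bit_def err_def x0_def)
  have bit1: "bit x1 i \<longleftrightarrow> carrier i" if "i < n" for i
    using that inV fin by (simp add: bit_def x1_def)
  have err1: "\<not> err x1 v" if "v \<in> V" for v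
    using that fin by (simp add: err_def x1_def carrier_def)
  have x0: "x0 \<in> set_pmf p"
    unfolding supp_iff
  proof (intro conjI ballI)
    show "x0 \<in> Pi\<^sub>E V \<X>"
      by (auto simp: x0_def \<X>_def image_iff intro!: bexI[of _ "{}"])
    fix v assume "v \<in> V"
    have "\<not> clash x0 v"
      unfolding clash_def using bit0(1) v_struct_nbrs(3,4) \<open>v \<in> V\<close> unfolding carrier_def by blast
    moreover have "\<forall>w\<in>parents A v. \<not> err x0 w"
      using bit0(2)[OF \<open>0 < n\<close>] A by (auto simp: parents_def)
    ultimately show "consistent v x0 (set_decode (x0 v))"
      using \<open>v \<in> V\<close> bit0 by (auto simp: consistent_def x0_def[THEN fun_cong] carrier_def)
  qed
  have x1: "x1 \<in> set_pmf p"
    unfolding supp_iff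
  proof (intro conjI ballI)
    show "x1 \<in> Pi\<^sub>E V \<X>"
      by (auto simp: x1_def \<X>_def image_iff carrier_def intro!: bexI[of _ "{i. carrier i \<and> vs ! i = _}"])
    fix v assume v: "v \<in> V"
    have "\<not> clash x1 v"
      unfolding clash_def using bit1 v_struct_nbrs(3,4) carrier_def by blast
    moreover have "\<forall>w\<in>parents A v. \<not> err x1 w"
      using err1 A by (auto simp: parents_def)
    moreover have "set_decode (x1 v) = {i. carrier i \<and> vs ! i = v}"
      using v fin by (simp add: x1_def)
    moreover have "carrier (i - 1)" if "carrier i" "0 < i" "(vs ! (i - 1), vs ! i) \<in> A" for i
      using that acyclic_no_2_cycle[OF A(2)] by (auto simp: carrier_def v_structure_def)
    moreover have "carrier (Suc i)" if "carrier i" "Suc i < n" "(vs ! Suc i, vs ! i) \<in> A" for i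
      using that acyclic_no_2_cycle[OF A(2)] by (auto simp: carrier_def v_structure_def)
    moreover have "i - 1 < n" if "carrier i" for i
      using that by (auto simp: carrier_def)
    ultimately show "consistent v x1 (set_decode (x1 v))"
      using bit1 by (auto simp: consistent_def carrier_def)
  qed
  have transmit: "bit x i \<longleftrightarrow> bit x 0"
    if x: "x \<in> set_pmf p" and xZ: "restrict x Z = restrict x0 Z" and i: "carrier i" for x i
  proof -
    have cons: "consistent v x (set_decode (x v))" if "v \<in> V" for v
      using x that by (simp add: supp_iff)
    have nbrs: "(0 < i \<and> (vs ! (i - 1), vs ! i) \<in> A \<longrightarrow> (bit x i \<longleftrightarrow> bit x (i - 1))) \<and>
        (Suc i < n \<and> (vs ! Suc i, vs ! i) \<in> A \<longrightarrow> (bit x i \<longleftrightarrow> bit x (Suc i)))" if "carrier i" for i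
    proof -
      have "consistent (vs ! i) x (set_decode (x (vs ! i)))"
        using that by (intro cons inV) (simp add: carrier_def)
      then show ?thesis
        using that unfolding consistent_def bit_def[of x i] by blast
    qed
    have copy_pred: "bit x i \<longleftrightarrow> bit x (i - 1)" if "carrier i" "0 < i" "(vs ! (i - 1), vs ! i) \<in> A" for i
      using nbrs that by blast
    have copy_succ: "bit x i \<longleftrightarrow> bit x (Suc i)" if "carrier i" "Suc i < n" "(vs ! Suc i, vs ! i) \<in> A" for i
      using nbrs that by blast
    have err_up: "err x w" if "(u, w) \<in> A\<^sup>*" "err x u" for u w
      using that
    proof (induction rule: rtrancl_induct)
      case (step w w')
      then show ?case
        using cons[of w'] A unfolding consistent_def err_def[of x w'] parents_def by blast
    qed
    have no_clash: "bit x (i - 1) \<longleftrightarrow> bit x (Suc i)" if i: "v_structure A vs i" for i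
    proof (rule ccontr)
      assume "bit x (i - 1) \<noteq> bit x (Suc i)"
      then have "clash x (vs ! i)"
        using i by (auto simp: clash_def)
      moreover have "i < n"
        using v_struct_nbrs[OF i] by simp
      ultimately have "err x (vs ! i)"
        using cons[OF inV] unfolding consistent_def err_def by blast
      moreover have "descendants A (vs ! i) \<inter> Z \<noteq> {}"
        using active i \<open>i < n\<close> unfolding trail_active_def n_def by presburger
      then obtain z where z: "(vs ! i, z) \<in> A\<^sup>*" "z \<in> Z"
        by (auto simp: descendants_def)
      ultimately have "err x z"
        using err_up by blast
      moreover have "z \<in> V"
        using z(1) inV[OF \<open>i < n\<close>] A by (induction rule: rtrancl_induct) auto
      moreover have "x z = x0 z"
        using xZ z by (metis restrict_apply')
      ultimately show False
        by (simp add: err_def x0_def)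
    qed
    show ?thesis
      using i
    proof (induction i rule: less_induct)
      case (less i)
      show ?case
      proof (cases i)
        case (Suc j)
        then have "j < n" "Suc j < n"
          using less.prems by (auto simp: carrier_def)
        show ?thesis
        proof (cases "v_structure A vs j")
          case True
          then have "bit x (j - 1) \<longleftrightarrow> bit x 0"
            using v_struct_nbrs[OF True] Suc by (intro less.IH) auto
          then show ?thesis
            using no_clash[OF True] Suc by simp
        next
          case False
          then have j: "carrier j"
            using \<open>j < n\<close> by (simp add: carrier_def)
          have "bit x (Suc j) \<longleftrightarrow> bit x j"
            using adj[OF \<open>Suc j < n\<close>]
          proof
            assume "(vs ! j, vs ! Suc j) \<in> A"
            then show ?thesis
              using copy_pred[of "Suc j"] less.prems Suc by simp
          next
            assume "(vs ! Suc j, vs ! j) \<in> A"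
            then show ?thesis
              using copy_succ[of j] j \<open>Suc j < n\<close> by simp
          qed
          then show ?thesis
            using less.IH[OF _ j] Suc by simp
        qed
      qed simp
    qed
  qed
  have "\<not> cond_indep p S T Z"
  proof (rule not_cond_indep_if_incompatible[OF x0 x1])
    show "restrict x0 Z = restrict x1 Z"
    proof (rule restrict_ext)
      fix z assume "z \<in> Z"
      then have "{i. carrier i \<and> vs ! i = z} = {}"
        using carrier_notin by auto
      then show "x0 z = x1 z"
        by (simp only: x0_def x1_def restrict_apply set_encode_empty)
    qed
    have ends_carrier: "carrier 0" "carrier (n - 1)"
      using \<open>0 < n\<close> by (auto simp: carrier_def v_structure_def n_def)
    have nth_ends: "vs ! 0 \<in> S" "vs ! (n - 1) \<in> T"
      using ends vs by (auto simp: n_def hd_conv_nth last_conv_nth)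
    fix w assume w: "w \<in> set_pmf p" "restrict w Z = restrict x0 Z" and wS: "restrict w S = restrict x0 S"
    have "w (vs ! 0) = x0 (vs ! 0)"
      using wS nth_ends by (metis restrict_apply')
    then have "\<not> bit w 0"
      using inV[of 0] \<open>0 < n\<close> by (simp add: bit_def x0_def)
    then have "\<not> bit w (n - 1)"
      using transmit[OF w ends_carrier(2)] by simp
    moreover have "bit x1 (n - 1)"
      using bit1 ends_carrier(2) by (simp add: carrier_def)
    ultimately have "w (vs ! (n - 1)) \<noteq> x1 (vs ! (n - 1))"
      by (auto simp: bit_def)
    then show "restrict w T \<noteq> restrict x1 T"
      using nth_ends by (metis restrict_apply')
  qed
  then show ?thesis
    using p by blast
qed


section \<open>Markov blankets\<close>

theorem global_markov_undirected:
  assumes "finite_undirected_graph V A" and "S \<subseteq> V"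
  shows "(\<forall>\<X> p. factorizes_undirected V A \<X> p \<longrightarrow> cond_indep p S T Z) \<longleftrightarrow> separates V A Z S T"
  using cond_indep_if_separates[OF assms] dependent_if_not_separates[OF assms(1)] by blast

theorem global_markov_directed:
  assumes "finite_acyclic_digraph V A" and "S \<subseteq> V" "T \<subseteq> V" "Z \<subseteq> V"
  shows "(\<forall>\<X> p. factorizes_directed V A \<X> p \<longrightarrow> cond_indep p S T Z) \<longleftrightarrow> d_separates V A Z S T"
  using cond_indep_if_d_separates[OF assms] dependent_if_not_d_separates[OF assms(1)] by blast

text \<open>
  For \<open>v \<notin> M\<close>, the set \<open>E \<union> (C - (B \<union> {v}))\<close> exceeds \<open>M \<union> E\<close> only by vertices of \<open>C - (B \<union> M)\<close>.
  So a path stays active when the conditioning set shrinks; and a path that is active given \<open>M \<union> E\<close>,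
  cut at its last vertex \<open>v\<close> in \<open>C - (B \<union> M)\<close>, is active given the larger set.
\<close>

lemma separates_outside_iff_each:
  assumes BC: "B \<inter> C \<subseteq> E" and M: "M \<subseteq> C"
  shows "separates V A (M \<union> E) (C - (B \<union> M)) B \<longleftrightarrow>
         {v \<in> C. \<not> separates V A (E \<union> (C - (B \<union> {v}))) {v} B} \<subseteq> M"
proof
  assume sep: "separates V A (M \<union> E) (C - (B \<union> M)) B"
  show "{v \<in> C. \<not> separates V A (E \<union> (C - (B \<union> {v}))) {v} B} \<subseteq> M"
  proof (rule ccontr)
    assume "\<not> ?thesis"
    then obtain v vs where v: "v \<in> C" "v \<notin> M" and vs: "graph_path V A vs"
        "path_active (E \<union> (C - (B \<union> {v}))) vs" "hd vs = v" "last vs \<in> B"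
      by (auto simp: separates_def)
    have "M \<union> E \<subseteq> E \<union> (C - (B \<union> {v}))"
      using BC M v by auto
    then have "path_active (M \<union> E) vs"
      using vs(2) by (auto simp: path_active_def)
    moreover have "v \<notin> E"
      using vs hd_in_set[of vs] by (auto simp: graph_path_def path_active_def)
    then have "v \<in> C - (B \<union> M)"
      using v BC by auto
    ultimately show False
      using sep vs by (auto simp: separates_def)
  qed
next
  assume sub: "{v \<in> C. \<not> separates V A (E \<union> (C - (B \<union> {v}))) {v} B} \<subseteq> M"
  show "separates V A (M \<union> E) (C - (B \<union> M)) B"
    unfolding separates_def
  proof (rule notI, elim exE conjE)
    fix vs assume vs: "graph_path V A vs" "path_active (M \<union> E) vs" "hd vs \<in> C - (B \<union> M)" "last vs \<in> B"
    then have "hd vs \<in> set vs"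
      by (auto simp: graph_path_def)
    then have "\<exists>u\<in>set vs. u \<in> C - (B \<union> M)"
      using vs by blast
    from split_list_last_prop[OF this] obtain xs u ys where split: "vs = xs @ u # ys" and u: "u \<in> C - (B \<union> M)"
      and later: "\<forall>y\<in>set ys. y \<notin> C - (B \<union> M)"
      by blast
    have "graph_path V A (u # ys)"
      using vs(1) by (auto simp: split graph_path_def successively_append_iff)
    moreover have "path_active (E \<union> (C - (B \<union> {u}))) (u # ys)"
      using vs(2) u later by (auto simp: split path_active_def)
    moreover have "last (u # ys) \<in> B"
      using vs(4) by (simp add: split)
    ultimately have "\<not> separates V A (E \<union> (C - (B \<union> {u}))) {u} B"
      unfolding separates_def by (metis insertI1 list.sel(1))
    then show False
      using sub u by auto
  qed
qed

text \<open>
  Unlike for paths, shrinking the conditioning set from \<open>E \<union> (C - (B \<union> {v}))\<close> to \<open>M \<union> E\<close> can block a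
  trail, namely at a v-structure whose observed descendants are all lost. A lost descendant is a
  vertex of \<open>C - (B \<union> M)\<close>, hence as good a starting point as \<open>v\<close>: the last vertex of the trail
  that loses all its observed descendants is reached from one of them against the arrows, and from there
  on nothing is blocked. When the conditioning set grows, v-structures only gain
  observed descendants, and cutting at the last vertex of \<open>C - (B \<union> M \<union> E)\<close> works as for paths.
\<close>

lemma d_separates_outside_iff_each:
  assumes G: "finite_acyclic_digraph V A" and BC: "B \<inter> C \<subseteq> E" and M: "M \<subseteq> C"
  shows "d_separates V A (M \<union> E) (C - (B \<union> M)) B \<longleftrightarrow>
         {v \<in> C. \<not> d_separates V A (E \<union> (C - (B \<union> {v}))) {v} B} \<subseteq> M"
proof
  assume sep: "d_separates V A (M \<union> E) (C - (B \<union> M)) B"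
  show "{v \<in> C. \<not> d_separates V A (E \<union> (C - (B \<union> {v}))) {v} B} \<subseteq> M"
  proof (rule ccontr)
    assume "\<not> ?thesis"
    then obtain v vs where v: "v \<in> C" "v \<notin> M" and vs: "trail V A vs"
        "trail_active A (E \<union> (C - (B \<union> {v}))) vs" "hd vs = v" "last vs \<in> B"
      by (auto simp: d_separates_def)
    let ?Z = "M \<union> E" and ?Z' = "E \<union> (C - (B \<union> {v}))"
    have Z: "?Z \<subseteq> ?Z'"
      using BC M v by auto
    have "vs = v # tl vs"
      using vs by (cases vs) (auto simp: trail_def)
    then have "v \<notin> ?Z'"
      using vs(2) hd_notin_if_trail_active by metis
    then have vB: "v \<in> C - (B \<union> M)"
      using v BC by auto
    define blocked where "blocked u \<longleftrightarrow> descendants A u \<inter> ?Z' \<noteq> {} \<and> descendants A u \<inter> ?Z = {}" for u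
    have upgrade: "active_at A ?Z us i"
      if "active_at A ?Z' us i" "\<not> blocked (us ! i)" for us i
      using that Z by (auto simp: active_at_def blocked_def)
    show False
    proof (cases "\<exists>u\<in>set vs. blocked u")
      case False
      then have "trail_active A ?Z vs"
        using vs(2) upgrade by (auto simp: trail_active_iff_active_at)
      then show False
        using sep vs vB unfolding d_separates_def by blast
    next
      case True
      from split_list_last_prop[OF this] obtain xs u ys where split: "vs = xs @ u # ys" and u: "blocked u"
        and later: "\<forall>y\<in>set ys. \<not> blocked y"
        by blast
      have uZ: "u \<notin> ?Z" "descendants A u \<inter> ?Z = {}"
        using u by (auto simp: blocked_def descendants_def)
      have "u \<in> V"
        using vs(1) by (auto simp: split trail_def)
      obtain w where w: "w \<in> ?Z'" "(u, w) \<in> A\<^sup>*"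
        using u by (auto simp: blocked_def descendants_def)
      then have "w \<in> C - (B \<union> M)"
        using uZ by (auto simp: descendants_def)
      obtain zs where zs: "active_trail V A ?Z (zs @ [u])" "hd (zs @ [u]) = w" "zs = [] \<or> (u, last zs) \<in> A"
        using active_trail_from_descendant[OF G w(2) \<open>u \<in> V\<close> uZ(2)] by blast
      have "active_at A ?Z (u # ys) j" if "0 < j" "j < length (u # ys)" for j
      proof (rule upgrade)
        show "active_at A ?Z' (u # ys) j"
          using vs(2) that unfolding split trail_active_append_iff by blast
        show "\<not> blocked ((u # ys) ! j)"
          using later that by (cases j) auto
      qed
      then have "trail_active A ?Z (u # ys)"
        using uZ by (simp add: trail_active_Cons_iff)
      moreover have "trail V A (u # ys)"
        using vs(1) by (auto simp: split trail_def successively_append_iff)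
      ultimately have uys: "active_trail V A ?Z (u # ys)"
        by simp
      have "(last zs, u) \<notin> A" if "zs \<noteq> []"
        using that zs(3) G acyclic_no_2_cycle[of A u "last zs"] by (auto simp: finite_acyclic_digraph_def)
      then have "active_trail V A ?Z (zs @ u # ys)"
        by (intro active_trail_glue[OF zs(1) uys]) auto
      moreover have "hd (zs @ u # ys) = w"
        using zs(2) by (cases zs) auto
      moreover have "last (zs @ u # ys) \<in> B"
        using vs(4) by (simp add: split)
      ultimately show False
        using sep \<open>w \<in> C - (B \<union> M)\<close> unfolding d_separates_def by blast
    qed
  qed
next
  assume sub: "{v \<in> C. \<not> d_separates V A (E \<union> (C - (B \<union> {v}))) {v} B} \<subseteq> M"
  show "d_separates V A (M \<union> E) (C - (B \<union> M)) B"
    unfolding d_separates_def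
  proof (rule notI, elim exE conjE)
    fix vs assume vs: "trail V A vs" "trail_active A (M \<union> E) vs" "hd vs \<in> C - (B \<union> M)" "last vs \<in> B"
    have "vs = hd vs # tl vs"
      using vs by (cases vs) (auto simp: trail_def)
    then have "hd vs \<in> set vs" "hd vs \<notin> M \<union> E"
      using vs(2) hd_notin_if_trail_active by (metis list.set_intros(1))+
    then have "\<exists>u\<in>set vs. u \<in> C - (B \<union> M \<union> E)"
      using vs(3) by blast
    from split_list_last_prop[OF this] obtain xs u ys where split: "vs = xs @ u # ys" and u: "u \<in> C - (B \<union> M \<union> E)"
      and later: "\<forall>y\<in>set ys. y \<notin> C - (B \<union> M \<union> E)"
      by blast
    let ?Z' = "E \<union> (C - (B \<union> {u}))"
    have Z: "M \<union> E \<subseteq> ?Z'"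
      using BC M u by auto
    have uys: "active_trail V A (M \<union> E) (u # ys)"
      using vs u by (intro active_trail_suffix[where xs = xs]) (auto simp: split)
    have "active_at A ?Z' (u # ys) j" if "0 < j" "j < length (u # ys)" for j
    proof -
      have "(u # ys) ! j \<in> set ys"
        using that by (cases j) auto
      then have "(u # ys) ! j \<notin> ?Z'" if "(u # ys) ! j \<notin> M \<union> E"
        using later that by blast
      moreover have "active_at A (M \<union> E) (u # ys) j"
        using uys that by (simp add: trail_active_iff_active_at)
      ultimately show ?thesis
        using Z unfolding active_at_def by (auto split: if_splits)
    qed
    then have "trail_active A ?Z' (u # ys)"
      using u by (simp add: trail_active_Cons_iff)
    moreover have "last (u # ys) \<in> B"
      using vs(4) by (simp add: split)
    ultimately have "\<not> d_separates V A ?Z' {u} B"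
      using uys unfolding d_separates_def by (metis insertI1 list.sel(1))
    then show False
      using sub u by auto
  qed
qed

lemma markov_blanket_eqI:
  assumes "N \<subseteq> C" and "\<And>M. M \<subseteq> C \<Longrightarrow> blanket_condition F C B E M \<longleftrightarrow> N \<subseteq> M"
  shows "(\<exists>!N. is_markov_blanket F C B E N) \<and> markov_blanket F C B E = N"
proof -
  have N: "is_markov_blanket F C B E N"
    using assms by (auto simp: is_markov_blanket_def)
  have "N' = N" if "is_markov_blanket F C B E N'" for N'
    using that N unfolding is_markov_blanket_def by (metis order_refl subset_antisym)
  then show ?thesis
    using N unfolding markov_blanket_def by (metis the_equality)
qed

theorem theorem1:
  fixes V :: "'v set" and A :: "'v rel" and B C E :: "'v set"
  assumes "B \<subseteq> V" and "C \<subseteq> V" and "E \<subseteq> V"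
    and "B \<inter> C \<subseteq> E"
  shows "(finite_undirected_graph V A \<longrightarrow>
            (\<exists>!N. is_markov_blanket (factorizes_undirected V A) C B E N) \<and>
            markov_blanket (factorizes_undirected V A) C B E =
              {v \<in> C. \<not> separates V A (E \<union> (C - (B \<union> {v}))) {v} B}) \<and>
         (finite_acyclic_digraph V A \<longrightarrow>
            (\<exists>!N. is_markov_blanket (factorizes_directed V A) C B E N) \<and>
            markov_blanket (factorizes_directed V A) C B E =
              {v \<in> C. \<not> d_separates V A (E \<union> (C - (B \<union> {v}))) {v} B})"
proof (intro conjI[of "_ \<longrightarrow> _"] impI)
  assume G: "finite_undirected_graph V A"
  show "(\<exists>!N. is_markov_blanket (factorizes_undirected V A) C B E N) \<and>
        markov_blanket (factorizes_undirected V A) C B E =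
          {v \<in> C. \<not> separates V A (E \<union> (C - (B \<union> {v}))) {v} B}"
  proof (rule markov_blanket_eqI)
    fix M assume "M \<subseteq> C"
    have "blanket_condition (factorizes_undirected V A) C B E M \<longleftrightarrow>
        (\<forall>\<X> p. factorizes_undirected V A \<X> p \<longrightarrow> cond_indep p (C - (B \<union> M)) B (M \<union> E))"
      unfolding blanket_condition_def by (metis cond_indep_sym)
    also have "\<dots> \<longleftrightarrow> separates V A (M \<union> E) (C - (B \<union> M)) B"
      using assms by (intro global_markov_undirected[OF G]) auto
    also have "\<dots> \<longleftrightarrow> {v \<in> C. \<not> separates V A (E \<union> (C - (B \<union> {v}))) {v} B} \<subseteq> M"
      by (rule separates_outside_iff_each) fact+
    finally show "blanket_condition (factorizes_undirected V A) C B E M \<longleftrightarrow>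
        {v \<in> C. \<not> separates V A (E \<union> (C - (B \<union> {v}))) {v} B} \<subseteq> M" .
  qed auto
next
  assume G: "finite_acyclic_digraph V A"
  show "(\<exists>!N. is_markov_blanket (factorizes_directed V A) C B E N) \<and>
        markov_blanket (factorizes_directed V A) C B E =
          {v \<in> C. \<not> d_separates V A (E \<union> (C - (B \<union> {v}))) {v} B}"
  proof (rule markov_blanket_eqI)
    fix M assume "M \<subseteq> C"
    have "blanket_condition (factorizes_directed V A) C B E M \<longleftrightarrow>
        (\<forall>\<X> p. factorizes_directed V A \<X> p \<longrightarrow> cond_indep p (C - (B \<union> M)) B (M \<union> E))"
      unfolding blanket_condition_def by (metis cond_indep_sym)
    also have "\<dots> \<longleftrightarrow> d_separates V A (M \<union> E) (C - (B \<union> M)) B"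
      using assms \<open>M \<subseteq> C\<close> by (intro global_markov_directed[OF G]) auto
    also have "\<dots> \<longleftrightarrow> {v \<in> C. \<not> d_separates V A (E \<union> (C - (B \<union> {v}))) {v} B} \<subseteq> M"
      by (rule d_separates_outside_iff_each) fact+
    finally show "blanket_condition (factorizes_directed V A) C B E M \<longleftrightarrow>
        {v \<in> C. \<not> d_separates V A (E \<union> (C - (B \<union> {v}))) {v} B} \<subseteq> M" .
  qed auto
qed

end
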